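(* Let $K\subset\mathbb C^n$ be a non-pluripolar compact set, let $a\in K$, $\tau>0$, let $\Psi\in\mathcal L_\tau\cap C(\mathbb C^n)$, and put $\psi=\Psi|_K$. Assume that, for some $R>0$ and $c>0$, $dd^c\Psi\ge c\,\omega_0$ on $B(a,R)$, i.e. $\Psi-c\|z-a\|^2$ is plurisubharmonic on $B(a,R)$. Then for $0<r<R$ and every $\delta\ge\tau$, $$F_\delta(a)-\Psi(a)\ge cr^2\left(1+h_{K\cap\overline B(a,r),B(a,R)}^*(a)\right).$$ Consequently, for each single $\delta\ge\tau$, $(\delta,\psi)$-regularity at $a$ (that is, $F_\delta(a)=\psi(a)$) is equivalent to local pluriregularity of $K$ at $a$. If $F_\delta(a)=\psi(a)$ holds for one $\delta\ge\tau$, it holds for every $\delta\ge\tau$.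
   Context: Write $\log^+t=\max\{\log t,0\}$, $\log^+0=0$; $\|\cdot\|$ is the Euclidean norm, $B(a,r)$ the open Euclidean ball, $\omega_0=dd^c\|z\|^2$ with $dd^c=\frac i2\partial\bar\partial$. For $\delta>0$, $\mathcal L_\delta=\{u\in \mathrm{PSH}(\mathbb C^n): u(z)\le\delta\log^+\|z\|+C_u \text{ on }\mathbb C^n\}$. $f^*(z)=\limsup_{\zeta\to z}f(\zeta)$ is the upper semicontinuous regularization. $V_{\delta,K,\psi}(z)=\sup\{u(z):u\in\mathcal L_\delta,\ u\le\psi\text{ on }K\}$, $F_\delta=V_{\delta,K,\psi}^*$, and for bounded $E$, $V_E=\sup\{u:u\in\mathcal L_1,u\le0\text{ on }E\}$. $K$ is locally pluriregular at $a$ if $V_{K\cap\overline B(a,r)}^*(a)=0$ for every $r>0$. For $E$ relatively compact in a ball $B$, the relative extremal function is $h_{E,B}=\sup\{u\in\mathrm{PSH}(B):-1\le u\le0,\ u|_E\le-1\}$. A set is pluripolar if near each point it is contained in the $-\infty$ locus of a plurisubharmonic function not identically $-\infty$. (A standard fact: $K$ is locally pluriregular at $a$ iff $h^*_{K\cap\overline B(a,r),B(a,R)}(a)=-1$ for $0<r<R$, for sufficiently small concentric balls.) *)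

theory Defs
  imports "HOL-Analysis.Analysis"
begin

text \<open>
  Functions with values in \<open>[-\<infinity>, \<infinity>)\<close> are rendered as total functions into \<^typ>\<open>ereal\<close>; for a
  function on an open set the values outside that set are irrelevant.
\<close>

text \<open>
  The mean over \<open>[0, 2\<pi>]\<close> of an extended-real function, as the integral of the positive part minus
  the integral of the negative part (\<^const>\<open>e2ennreal\<close> sends negative numbers to 0).
  For a function that is bounded above, as in \<open>psh_on\<close> below, the first integral is finite, so the
  difference is the Lebesgue integral with values in \<open>[-\<infinity>, \<infinity>)\<close>.
\<close>

definition circle_mean :: "(real \<Rightarrow> ereal) \<Rightarrow> ereal" where
  "circle_mean f =
     (enn2ereal (\<integral>\<^sup>+\<theta>\<in>{0..2 * pi}. e2ennreal (f \<theta>) \<partial>lborel)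
      - enn2ereal (\<integral>\<^sup>+\<theta>\<in>{0..2 * pi}. e2ennreal (- f \<theta>) \<partial>lborel)) / ereal (2 * pi)"

text \<open>
  Plurisubharmonic functions: upper semicontinuous, and satisfying the sub-mean value inequality on
  every closed disc of a complex line contained in the open set. The constant \<open>-\<infinity>\<close> is admitted.
\<close>

definition psh_on :: "(complex ^ 'n) set \<Rightarrow> (complex ^ 'n \<Rightarrow> ereal) \<Rightarrow> bool" where
  "psh_on \<Omega> u \<longleftrightarrow>
     open \<Omega> \<and>
     (\<forall>z\<in>\<Omega>. u z \<noteq> \<infinity>) \<and>
     (\<forall>t. open {z \<in> \<Omega>. u z < t}) \<and>
     (\<forall>z b. (\<forall>\<zeta>. norm \<zeta> \<le> 1 \<longrightarrow> z + \<zeta> *s b \<in> \<Omega>) \<longrightarrow>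
        u z \<le> circle_mean (\<lambda>\<theta>. u (z + cis \<theta> *s b)))"

text \<open>Since \<^prop>\<open>ln (0::real) = 0\<close>, this has the value 0 at 0.\<close>

definition log_plus :: "real \<Rightarrow> real" where
  "log_plus t = max (ln t) 0"

definition lelong_class :: "real \<Rightarrow> (complex ^ 'n \<Rightarrow> ereal) set" where
  "lelong_class \<delta> =
     {u. psh_on UNIV u \<and> (\<exists>C::real. \<forall>z. u z \<le> ereal (\<delta> * log_plus (norm z) + C))}"

text \<open>The upper semicontinuous regularization; the filter \<^term>\<open>nhds z\<close> includes the point \<open>z\<close>.\<close>

definition usc_reg :: "(complex ^ 'n \<Rightarrow> ereal) \<Rightarrow> complex ^ 'n \<Rightarrow> ereal" where
  "usc_reg f z = Limsup (nhds z) f"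

definition weighted_extremal ::
    "real \<Rightarrow> (complex ^ 'n) set \<Rightarrow> (complex ^ 'n \<Rightarrow> real) \<Rightarrow> complex ^ 'n \<Rightarrow> ereal" where
  "weighted_extremal \<delta> K \<psi> z =
     (SUP u \<in> {u \<in> lelong_class \<delta>. \<forall>w\<in>K. u w \<le> ereal (\<psi> w)}. u z)"

definition weighted_extremal_reg ::
    "real \<Rightarrow> (complex ^ 'n) set \<Rightarrow> (complex ^ 'n \<Rightarrow> real) \<Rightarrow> complex ^ 'n \<Rightarrow> ereal" where
  "weighted_extremal_reg \<delta> K \<psi> = usc_reg (weighted_extremal \<delta> K \<psi>)"

definition weighted_regular_at ::
    "real \<Rightarrow> (complex ^ 'n) set \<Rightarrow> (complex ^ 'n \<Rightarrow> real) \<Rightarrow> complex ^ 'n \<Rightarrow> bool" where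
  "weighted_regular_at \<delta> K \<psi> a \<longleftrightarrow> weighted_extremal_reg \<delta> K \<psi> a = ereal (\<psi> a)"

definition siciak_extremal :: "(complex ^ 'n) set \<Rightarrow> complex ^ 'n \<Rightarrow> ereal" where
  "siciak_extremal E z = (SUP u \<in> {u \<in> lelong_class 1. \<forall>w\<in>E. u w \<le> 0}. u z)"

definition locally_pluriregular_at :: "(complex ^ 'n) set \<Rightarrow> complex ^ 'n \<Rightarrow> bool" where
  "locally_pluriregular_at K a \<longleftrightarrow> (\<forall>r>0. usc_reg (siciak_extremal (K \<inter> cball a r)) a = 0)"

definition relative_extremal ::
    "(complex ^ 'n) set \<Rightarrow> (complex ^ 'n) set \<Rightarrow> complex ^ 'n \<Rightarrow> ereal" where
  "relative_extremal E B z =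
     (SUP u \<in> {u. psh_on B u \<and> (\<forall>w\<in>B. -1 \<le> u w \<and> u w \<le> 0) \<and> (\<forall>w\<in>E. u w \<le> -1)}. u z)"

text \<open>
  The neighbourhoods are taken connected, so that a function which is \<open>-\<infinity>\<close> on one component only
  is not a witness.
\<close>

definition pluripolar :: "(complex ^ 'n) set \<Rightarrow> bool" where
  "pluripolar E \<longleftrightarrow>
     (\<forall>z\<in>E. \<exists>U v. open U \<and> connected U \<and> z \<in> U \<and> psh_on U v \<and>
        (\<exists>w\<in>U. v w \<noteq> -\<infinity>) \<and> (\<forall>w\<in>E \<inter> U. v w = -\<infinity>))"

end

theory Submission
  imports Defs "HOL-Complex_Analysis.Cauchy_Integral_Formula"
begin

text \<open>
  For \<open>E = K \<inter> cball a r\<close> and a competitor \<open>u\<close> of the relative extremal function of \<open>E\<close> in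
  \<open>ball a R\<close>, the function \<open>\<Psi> - c \<parallel>z - a\<parallel>\<^sup>2 + c r\<^sup>2 (1 + u)\<close> is plurisubharmonic on \<open>ball a R\<close>, because the
  strict plurisubharmonicity of \<open>\<Psi>\<close> leaves room for the quadratic term. It is at most \<open>\<Psi>\<close> on \<open>E\<close>, where
  \<open>u \<le> -1\<close>, and outside \<open>cball a r\<close>, where \<open>c r\<^sup>2 < c \<parallel>z - a\<parallel>\<^sup>2\<close>. Its maximum with \<open>\<Psi>\<close>, continued by \<open>\<Psi>\<close>, is
  therefore a competitor for the weighted extremal function (\<open>glued_in_lelong_class\<close>). Taking the supremum over
  \<open>u\<close> and the upper limit at \<open>a\<close> gives the inequality (\<open>weighted_extremal_reg_ge\<close>).

  If \<open>K\<close> is locally pluriregular at \<open>a\<close>, then a weighted competitor \<open>u\<close> is at most \<open>\<Psi> a + \<epsilon>\<close> on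
  \<open>K \<inter> cball a r\<close> for small \<open>r\<close>, so it is at most \<open>\<Psi> a + \<epsilon> + \<delta> V\<close> with \<open>V\<close> the Siciak function of that piece,
  and \<open>V\<^sup>*\<close> vanishes at \<open>a\<close> (\<open>weighted_regular_if_pluriregular\<close>).

  Conversely, weighted regularity and the inequality force the regularized relative extremal function \<open>h\<^sup>*\<close> to be
  \<open>-1\<close> at \<open>a\<close>, and it remains to pass from \<open>h\<close> to \<open>V\<close>. Once the competitors of \<open>V\<close> have a common bound \<open>D\<close> on
  \<open>ball a R\<close>, this is the estimate \<open>V \<le> D (1 + h)\<close> (\<open>psh_le_relative_extremal\<close>). The common bound is a
  bootstrap (\<open>lelong_uniformly_bounded\<close>): near \<open>a\<close> one has \<open>h \<le> -1/2\<close>, so a competitor bounded by \<open>M\<close> on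
  \<open>ball a R\<close> is bounded by \<open>M/2\<close> on a small ball, and the growth condition carries this bound back to
  \<open>ball a R\<close> with a loss \<open>d\<close> that does not depend on the competitor (\<open>bernstein_walsh\<close>). The least bound hence
  satisfies \<open>M \<le> M/2 + d\<close>.

  The gluing requires that plurisubharmonicity, defined by circle means over all discs, is a local property
  (\<open>psh_on_Un\<close>). Everything about circle means goes through one criterion: for an upper semicontinuous \<open>f\<close> on the
  unit circle, \<open>x\<close> is at most the mean of \<open>f\<close> exactly if \<open>x \<le> Re (p 0)\<close> for each entire \<open>p\<close> with \<open>f < Re p\<close> on
  the circle (\<open>circle_mean_le_Re_holomorphic\<close> and \<open>le_circle_meanI\<close>). In this form, stability under maxima,
  sums and affine maps is elementary, and locality follows from the maximum principle for a difference \<open>v - Re p\<close>.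
\<close>

section \<open>Upper semicontinuous functions\<close>

definition usc_on :: "'a::topological_space set \<Rightarrow> ('a \<Rightarrow> ereal) \<Rightarrow> bool" where
  "usc_on S f \<longleftrightarrow> (\<forall>t. openin (top_of_set S) {x \<in> S. f x < t})"

lemma usc_on_open_iff: "open S \<Longrightarrow> usc_on S f \<longleftrightarrow> (\<forall>t. open {x \<in> S. f x < t})"
  unfolding usc_on_def by (auto simp: openin_open_eq)

lemma usc_on_compose:
  assumes "usc_on S f" "continuous_on T h" "h ` T \<subseteq> S"
  shows "usc_on T (\<lambda>x. f (h x))"
  unfolding usc_on_def
proof
  fix t
  have "openin (top_of_set T) (T \<inter> h -` {x \<in> S. f x < t})"
    by (rule continuous_openin_preimage[OF assms(2), of S]) (use assms in \<open>auto simp: usc_on_def\<close>)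
  moreover have "T \<inter> h -` {x \<in> S. f x < t} = {x \<in> T. f (h x) < t}"
    using assms(3) by auto
  ultimately show "openin (top_of_set T) {x \<in> T. f (h x) < t}" by simp
qed

lemma usc_on_subset: "usc_on S f \<Longrightarrow> T \<subseteq> S \<Longrightarrow> usc_on T f"
  using usc_on_compose[of S f T "\<lambda>x. x"] by simp

lemma usc_on_add_continuous:
  fixes f :: "'a::topological_space \<Rightarrow> ereal"
  assumes "usc_on S f" "continuous_on S k"
  shows "usc_on S (\<lambda>x. f x + ereal (k x))"
  unfolding usc_on_def
proof
  fix t
  have "{x \<in> S. f x + ereal (k x) < t} =
        (\<Union>q::real. {x \<in> S. f x < ereal q} \<inter> (S \<inter> (\<lambda>x. ereal (q + k x)) -` {..<t})) \<union> (if t = \<infinity> then {x \<in> S. f x < \<infinity>} else {})"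
    (is "?L = ?R")
  proof (intro equalityI subsetI)
    fix x assume "x \<in> ?L"
    hence x: "x \<in> S" "f x + ereal (k x) < t" by auto
    show "x \<in> ?R"
    proof (cases t)
      case (real r)
      with x have "f x < ereal (r - k x)" by (cases "f x") auto
      then obtain q where "f x < ereal q" "ereal q < ereal (r - k x)"
        using ereal_dense2 by blast
      thus ?thesis using x(1) real by auto
    qed (use x in auto)
  next
    fix x assume "x \<in> ?R"
    thus "x \<in> ?L" 
    proof (cases "t = \<infinity>")
      case True thus ?thesis using \<open>x \<in> ?R\<close> by (auto simp: less_top[symmetric] top_ereal_def)
    next
      case False
      then obtain q where q: "x \<in> S" "f x < ereal q" "ereal (q + k x) < t" using \<open>x \<in> ?R\<close> by auto
      have "f x + ereal (k x) \<le> ereal (q + k x)" using q(2) by (cases "f x") auto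
      thus ?thesis using q by auto
    qed
  qed
  moreover have "openin (top_of_set S) ?R"
  proof (intro openin_Un openin_Union ballI)
    have *: "openin (top_of_set S) {x \<in> S. f x < t'}" for t'
      using assms(1) by (simp add: usc_on_def)
    show "openin (top_of_set S) (if t = \<infinity> then {x \<in> S. f x < \<infinity>} else {})"
      using *[of "\<infinity>"] by simp
    fix T assume "T \<in> range (\<lambda>q. {x \<in> S. f x < ereal q} \<inter> (S \<inter> (\<lambda>x. ereal (q + k x)) -` {..<t}))"
    then obtain q where "T = {x \<in> S. f x < ereal q} \<inter> (S \<inter> (\<lambda>x. ereal (q + k x)) -` {..<t})" by blast
    moreover have "openin (top_of_set S) (S \<inter> (\<lambda>x. ereal (q + k x)) -` {..<t})"
      by (intro continuous_openin_preimage_gen continuous_on_ereal continuous_intros assms(2))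
    ultimately show "openin (top_of_set S) T" using * by auto
  qed
  ultimately show "openin (top_of_set S) ?L" by simp
qed

lemma usc_on_attains_max:
  assumes "compact S" "S \<noteq> {}" "usc_on S f"
  obtains x where "x \<in> S" "\<And>y. y \<in> S \<Longrightarrow> f y \<le> f x"
proof (rule ccontr)
  assume "\<not> thesis"
  hence *: "\<exists>y\<in>S. f x < f y" if "x \<in> S" for x
    using \<open>x \<in> S\<close> \<open>\<And>x. x \<in> S \<Longrightarrow> (\<And>y. y \<in> S \<Longrightarrow> f y \<le> f x) \<Longrightarrow> thesis\<close>[of x] by force
  define \<A> where "\<A> = (\<lambda>y. {x \<in> S. f x < f y}) ` S"
  have "\<forall>c\<in>\<A>. openin (top_of_set S) c" using assms(3) by (auto simp: \<A>_def usc_on_def)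
  moreover have "S \<subseteq> \<Union>\<A>" using * by (auto simp: \<A>_def)
  ultimately obtain \<D> where \<D>: "\<D> \<subseteq> \<A>" "finite \<D>" "S \<subseteq> \<Union>\<D>"
    using assms(1)[unfolded compact_eq_openin_cover, rule_format, of \<A>] by auto
  obtain Y where Y: "Y \<subseteq> S" "finite Y" "\<D> = (\<lambda>y. {x \<in> S. f x < f y}) ` Y"
    using finite_subset_image[OF \<D>(2) \<D>(1)[unfolded \<A>_def]] by blast
  have "Y \<noteq> {}" using \<D>(3) assms(2) Y by auto
  hence "Max (f ` Y) \<in> f ` Y" using Y(2) by (intro Max_in) auto
  then obtain y where y: "y \<in> Y" "f y = Max (f ` Y)" by auto
  have "y \<in> \<Union>\<D>" using y(1) Y(1) \<D>(3) by blast
  then obtain y' where "y' \<in> Y" "f y < f y'" unfolding Y(3) by blast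
  moreover have "f y' \<le> Max (f ` Y)" using Y(2) \<open>y' \<in> Y\<close> by (intro Max_ge) auto
  ultimately show False using y(2) by simp
qed

lemma usc_on_bounded_above:
  assumes "compact S" "usc_on S f" "\<And>x. x \<in> S \<Longrightarrow> f x \<noteq> \<infinity>"
  obtains M :: real where "\<And>x. x \<in> S \<Longrightarrow> f x \<le> ereal M"
proof (cases "S = {}")
  case False
  obtain x where x: "x \<in> S" "\<And>y. y \<in> S \<Longrightarrow> f y \<le> f x"
    using usc_on_attains_max[OF assms(1) False assms(2)] by blast
  obtain M where "f x \<le> ereal M" using assms(3)[OF x(1)] by (cases "f x") auto
  thus ?thesis using that[of M] x(2) order_trans by blast
qed (use that in auto)

text \<open>
  The approximants are the sup-convolutions \<open>sup\<^bsub>w\<^esub> max (f w) (-n) - n dist x w\<close>. They are \<open>n\<close>-Lipschitz; the truncation at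
  \<open>-n\<close> makes them real-valued where \<open>f\<close> takes the value \<open>-\<infinity>\<close>.
\<close>

lemma usc_on_continuous_approx:
  fixes f :: "'a::metric_space \<Rightarrow> ereal"
  assumes "compact S" "usc_on S f" and fin: "\<And>x. x \<in> S \<Longrightarrow> f x \<noteq> \<infinity>"
  obtains g :: "nat \<Rightarrow> 'a \<Rightarrow> real" and M :: real where
    "\<And>n. continuous_on S (g n)"
    "\<And>n x. x \<in> S \<Longrightarrow> f x \<le> ereal (g n x)"
    "\<And>n x. x \<in> S \<Longrightarrow> g n x \<le> M"
    "\<And>x. x \<in> S \<Longrightarrow> (\<lambda>n. ereal (g n x)) \<longlonglongrightarrow> f x"
proof -
  obtain M0 where M0: "\<And>x. x \<in> S \<Longrightarrow> f x \<le> ereal M0"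
    by (rule usc_on_bounded_above[OF assms]) blast+
  define M where "M = max M0 0"
  define \<phi> where "\<phi> n w = real_of_ereal (max (f w) (ereal (- real n)))" for n w
  have \<phi>: "ereal (\<phi> n w) = max (f w) (ereal (- real n))" if "w \<in> S" for n w
    using fin[OF that] by (cases "f w") (auto simp: \<phi>_def max_def)
  have \<phi>M: "\<phi> n w \<le> M" if "w \<in> S" for n w
  proof -
    have "ereal (\<phi> n w) \<le> ereal M" unfolding \<phi>[OF that] using M0[OF that] by (auto simp: M_def max_def intro: order_trans)
    thus ?thesis by simp
  qed
  have \<phi>M': "\<phi> n w - real n * dist x w \<le> M" if "w \<in> S" for n x w
  proof -
    have "0 \<le> real n * dist x w" by simp
    thus ?thesis using \<phi>M[OF that, of n] by linarith
  qed
  define g where "g n x = (SUP w\<in>S. \<phi> n w - real n * dist x w)" for n x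
  have bdd: "bdd_above ((\<lambda>w. \<phi> n w - real n * dist x w) ` S)" for n x
    by (rule bdd_aboveI2[of _ _ M]) (rule \<phi>M')
  have upper: "\<phi> n w - real n * dist x w \<le> g n x" if "w \<in> S" for n x w
    unfolding g_def by (rule cSUP_upper[OF that bdd])
  have lower: "f x \<le> ereal (g n x)" if "x \<in> S" for n x
  proof -
    have "f x \<le> ereal (\<phi> n x)" using \<phi>[OF that] by simp
    also have "\<dots> \<le> ereal (g n x)" using upper[OF that, of n x] by simp
    finally show ?thesis .
  qed
  have gle: "g n x \<le> t" if "x \<in> S" "\<And>w. w \<in> S \<Longrightarrow> \<phi> n w - real n * dist x w \<le> t" for n x t
    unfolding g_def using that by (intro cSUP_least) auto
  have cont: "continuous_on S (g n)" for n
  proof -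
    have lip: "g n x \<le> g n y + real n * dist x y" if "x \<in> S" "y \<in> S" for x y
    proof (rule gle[OF that(1)])
      fix w assume "w \<in> S"
      have "real n * dist y w \<le> real n * (dist x y + dist x w)"
        by (intro mult_left_mono) (use dist_triangle[of y w x] in \<open>simp_all add: dist_commute\<close>)
      thus "\<phi> n w - real n * dist x w \<le> g n y + real n * dist x y"
        using upper[OF \<open>w \<in> S\<close>, of n y] by (simp add: algebra_simps)
    qed
    have "(real n)-lipschitz_on S (g n)"
    proof (rule lipschitz_onI)
      show "dist (g n x) (g n y) \<le> real n * dist x y" if "x \<in> S" "y \<in> S" for x y
        using lip[OF that] lip[OF that(2,1)] by (simp add: dist_real_def dist_commute)
    qed simp
    thus ?thesis by (rule lipschitz_on_continuous_on)
  qed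
  have lim: "(\<lambda>n. ereal (g n x)) \<longlonglongrightarrow> f x" if x: "x \<in> S" for x
  proof (rule order_tendstoI)
    fix t assume "t < f x"
    thus "eventually (\<lambda>n. t < ereal (g n x)) sequentially"
      using lower[OF x] by (auto intro: always_eventually less_le_trans)
  next
    fix t assume "f x < t"
    then obtain q where q: "f x < ereal q" "ereal q < t" using ereal_dense2 by blast
    have "openin (top_of_set S) {w \<in> S. f w < ereal q}" using assms(2) by (auto simp: usc_on_def)
    hence "\<forall>y\<in>{w \<in> S. f w < ereal q}. \<exists>\<rho>>0. \<forall>w\<in>S. dist w y < \<rho> \<longrightarrow> w \<in> {w \<in> S. f w < ereal q}"
      unfolding openin_euclidean_subtopology_iff by (rule conjunct2)
    from bspec[OF this, of x] x q(1)
    obtain \<rho> where \<rho>: "\<rho> > 0" "\<And>w. w \<in> S \<Longrightarrow> dist w x < \<rho> \<Longrightarrow> f w < ereal q"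
      by auto
    obtain N1 :: nat where N1: "real N1 \<ge> - q" using real_arch_simple by blast
    obtain N2 :: nat where N2: "real N2 \<ge> (M - q) / \<rho>" using real_arch_simple by blast
    have "ereal (g n x) < t" if n: "n \<ge> max N1 N2" for n
    proof -
      have "g n x \<le> q"
      proof (rule gle[OF x])
        fix w assume w: "w \<in> S"
        show "\<phi> n w - real n * dist x w \<le> q"
        proof (cases "dist w x < \<rho>")
          case True
          have "real N1 \<le> real n" using n by simp
          hence "ereal (- real n) \<le> ereal q" using N1 by simp
          hence "ereal (\<phi> n w) \<le> ereal q" unfolding \<phi>[OF w]
            using \<rho>(2)[OF w True] by simp
          hence "\<phi> n w \<le> q" by simp
          moreover have "real n * dist x w \<ge> 0" by simp
          ultimately show ?thesis by linarith
        next
          case False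
          have "M - q \<le> real N2 * \<rho>" using N2 \<rho>(1) by (simp add: field_simps)
          also have "\<dots> \<le> real n * dist x w"
            using n False \<rho>(1) by (intro mult_mono) (auto simp: dist_commute)
          finally show ?thesis using \<phi>M[OF w, of n] by simp
        qed
      qed
      hence "ereal (g n x) \<le> ereal q" by simp
      thus ?thesis using q(2) by (rule le_less_trans)
    qed
    thus "eventually (\<lambda>n. ereal (g n x) < t) sequentially"
      unfolding eventually_sequentially by blast
  qed
  have "g n x \<le> M" if "x \<in> S" for n x
    by (rule gle[OF that \<phi>M'])
  with cont lower lim show ?thesis by (intro that)
qed

section \<open>Real parts of entire functions on the unit circle\<close>

text \<open>
  Trigonometric polynomials, described by their values on the unit circle only. On the circle \<open>cnj z = 1/z\<close>, so real
  parts of monomials span an algebra, and every member is the real part of an entire function.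
\<close>

inductive trig_poly :: "(complex \<Rightarrow> real) \<Rightarrow> bool" where
  monomial: "(\<And>z. norm z = 1 \<Longrightarrow> f z = Re (c * z ^ k)) \<Longrightarrow> trig_poly f"
| add: "trig_poly f \<Longrightarrow> trig_poly g \<Longrightarrow> (\<And>z. norm z = 1 \<Longrightarrow> h z = f z + g z) \<Longrightarrow> trig_poly h"

text \<open>
  This is \<open>2 Re u Re v = Re (u v) + Re (cnj u v)\<close>, where \<open>cnj (z ^ j) z ^ k = z ^ (k - j)\<close> on the circle.
\<close>

lemma Re_mult_Re_unit:
  fixes z :: complex
  assumes "norm z = 1" "j \<le> k"
  shows "Re (c * z ^ j) * Re (d * z ^ k) = Re (c * d / 2 * z ^ (j + k)) + Re (cnj c * d / 2 * z ^ (k - j))"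
proof -
  define w where "w = z ^ j"
  have w: "cnj w * w = 1"
  proof -
    have "cnj w * w = of_real ((norm w)\<^sup>2)" by (metis complex_norm_square mult.commute)
    thus ?thesis using assms(1) by (simp add: w_def norm_power)
  qed
  define v where "v = z ^ (k - j)"
  have k: "z ^ k = w * v" unfolding w_def v_def using assms(2) by (simp flip: power_add)
  have "Re (c * w) * Re (d * (w * v)) = Re (c * w * (d * w * v)) / 2 + Re (cnj (c * w) * (d * w * v)) / 2"
    by (simp add: field_simps)
  also have "cnj (c * w) * (d * w * v) = cnj c * d * v * (cnj w * w)" by (simp add: ac_simps)
  also have "\<dots> = cnj c * d * v" using w by simp
  finally have *: "Re (c * w) * Re (d * (w * v)) = Re (c * w * (d * w * v)) / 2 + Re (cnj c * d * v) / 2" .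
  have h: "Re x / 2 = Re (x / 2)" for x by simp
  have e: "z ^ (j + k) = w * (w * v)" by (simp add: power_add k flip: w_def)
  show ?thesis unfolding k e w_def[symmetric] v_def[symmetric] using *[unfolded h] by (simp add: ac_simps)
qed

lemma trig_poly_mult_term:
  assumes "trig_poly f" "\<And>z. norm z = 1 \<Longrightarrow> h z = f z * Re (d * z ^ k)"
  shows "trig_poly h"
  using assms
proof (induction arbitrary: h rule: trig_poly.induct)
  case (monomial f c j)
  show ?case
  proof (cases "j \<le> k")
    case True
    show ?thesis
      by (rule trig_poly.add[OF trig_poly.monomial[of _ "c * d / 2" "j + k"] trig_poly.monomial[of _ "cnj c * d / 2" "k - j"]])
         (use monomial Re_mult_Re_unit[OF _ True] in auto)
  next
    case False
    hence F: "k \<le> j" by simp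
    show ?thesis
      by (rule trig_poly.add[OF trig_poly.monomial[of _ "d * c / 2" "k + j"] trig_poly.monomial[of _ "cnj d * c / 2" "j - k"]])
         (use monomial Re_mult_Re_unit[OF _ F, of _ d c] in \<open>auto simp: mult.commute\<close>)
  qed
next
  case (add f g h')
  show ?case
    by (rule trig_poly.add[OF add.IH(1)[of "\<lambda>z. f z * Re (d * z ^ k)"] add.IH(2)[of "\<lambda>z. g z * Re (d * z ^ k)"]])
       (simp_all only: add.hyps add.prems distrib_right)
qed

lemma trig_poly_mult:
  assumes "trig_poly g" "trig_poly f" "\<And>z. norm z = 1 \<Longrightarrow> h z = f z * g z"
  shows "trig_poly h"
  using assms
proof (induction arbitrary: h rule: trig_poly.induct)
  case (monomial g c j)
  thus ?case by (intro trig_poly_mult_term[of f h]) auto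
next
  case (add g1 g2 g)
  show ?case
    by (rule trig_poly.add[OF add.IH(1)[OF \<open>trig_poly f\<close>, of "\<lambda>z. f z * g1 z"] add.IH(2)[OF \<open>trig_poly f\<close>, of "\<lambda>z. f z * g2 z"]])
       (simp_all only: add.hyps add.prems distrib_left)
qed

lemma trig_poly_real_polynomial_function:
  "real_polynomial_function f \<Longrightarrow> trig_poly f"
proof (induction rule: real_polynomial_function.induct)
  case (linear f)
  have "f z = Re (Complex (f 1) (- f \<i>) * z ^ 1)" for z
  proof -
    interpret bounded_linear f by fact
    have "f z = f (Re z *\<^sub>R 1 + Im z *\<^sub>R \<i>)" by (rule arg_cong[of _ _ f]) (simp add: complex_eq_iff)
    also have "\<dots> = Re z * f 1 + Im z * f \<i>" by (simp only: add scaleR real_scaleR_def)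
    finally show ?thesis by simp
  qed
  thus ?case by (rule trig_poly.monomial)
next
  case (const c)
  show ?case by (rule trig_poly.monomial[of _ "of_real c" 0]) simp
next
  case (add f g)
  show ?case by (rule trig_poly.add[OF add.IH]) simp
next
  case (mult f g)
  show ?case by (rule trig_poly_mult[OF mult.IH(2,1)]) simp
qed

lemma trig_poly_entire:
  "trig_poly f \<Longrightarrow> \<exists>p. p holomorphic_on UNIV \<and> (\<forall>z. norm z = 1 \<longrightarrow> f z = Re (p z))"
proof (induction rule: trig_poly.induct)
  case (monomial f c k)
  thus ?case by (intro exI[of _ "\<lambda>z. c * z ^ k"]) (auto intro!: holomorphic_intros)
next
  case (add f g h)
  then obtain p q where "p holomorphic_on UNIV" "\<forall>z. norm z = 1 \<longrightarrow> f z = Re (p z)"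
     "q holomorphic_on UNIV" "\<forall>z. norm z = 1 \<longrightarrow> g z = Re (q z)" by blast
  thus ?case using add.hyps by (intro exI[of _ "\<lambda>z. p z + q z"]) (auto intro!: holomorphic_intros)
qed

text \<open>
  By the Stone-Weierstrass theorem it suffices to treat polynomials in the coordinates of the plane; on the circle these are
  trigonometric polynomials.
\<close>

lemma circle_approx_Re_entire:
  fixes f :: "complex \<Rightarrow> real"
  assumes "continuous_on (sphere 0 1) f" "e > 0"
  obtains p where "p holomorphic_on UNIV" "\<And>z. norm z = 1 \<Longrightarrow> \<bar>f z - Re (p z)\<bar> < e"
proof -
  obtain g where g: "real_polynomial_function g" "\<And>x. x \<in> sphere 0 1 \<Longrightarrow> \<bar>f x - g x\<bar> < e"
    using Stone_Weierstrass_real_polynomial_function[OF compact_sphere assms] by metis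
  from trig_poly_entire[OF trig_poly_real_polynomial_function[OF g(1)]]
  obtain p where p: "p holomorphic_on UNIV" "\<And>z. norm z = 1 \<Longrightarrow> g z = Re (p z)" by blast
  have "\<bar>f z - Re (p z)\<bar> < e" if "norm z = 1" for z using g(2)[of z] p(2)[OF that] that by simp
  with p(1) that show thesis by blast
qed

text \<open>
  A continuous majorant is raised by \<open>2/(n+1)\<close> before it is approximated up to \<open>1/(n+1)\<close>, so that the approximant
  stays strictly above \<open>f\<close>.
\<close>

lemma usc_on_circle_entire_approx:
  fixes f :: "complex \<Rightarrow> ereal"
  assumes "usc_on (sphere 0 1) f" "\<And>z. norm z = 1 \<Longrightarrow> f z \<noteq> \<infinity>"
  obtains p :: "nat \<Rightarrow> complex \<Rightarrow> complex" and M where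
    "\<And>n. p n holomorphic_on UNIV"
    "\<And>n z. norm z = 1 \<Longrightarrow> f z < ereal (Re (p n z))"
    "\<And>n z. norm z = 1 \<Longrightarrow> Re (p n z) \<le> M"
    "\<And>z. norm z = 1 \<Longrightarrow> (\<lambda>n. ereal (Re (p n z))) \<longlonglongrightarrow> f z"
proof -
  obtain g M where g:
    "\<And>n. continuous_on (sphere 0 1) (g n)"
    "\<And>n x. x \<in> sphere 0 1 \<Longrightarrow> f x \<le> ereal (g n x)"
    "\<And>n x. x \<in> sphere 0 1 \<Longrightarrow> g n x \<le> M"
    "\<And>x. x \<in> sphere 0 1 \<Longrightarrow> (\<lambda>n. ereal (g n x)) \<longlonglongrightarrow> f x"
    by (rule usc_on_continuous_approx[OF compact_sphere assms(1)]) (use assms(2) in auto)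
  have "\<exists>p. p holomorphic_on UNIV \<and> (\<forall>z. norm z = 1 \<longrightarrow> \<bar>g n z + 2 / real (Suc n) - Re (p z)\<bar> < 1 / real (Suc n))" for n
    by (rule circle_approx_Re_entire[of "\<lambda>z. g n z + 2 / real (Suc n)" "1 / real (Suc n)"])
       (auto intro!: continuous_intros g(1))
  then obtain p where p: "\<And>n. p n holomorphic_on UNIV"
    "\<And>n z. norm z = 1 \<Longrightarrow> \<bar>g n z + 2 / real (Suc n) - Re (p n z)\<bar> < 1 / real (Suc n)" by metis
  have bnd: "0 < Re (p n z) - g n z" "Re (p n z) - g n z \<le> 3 * (1 / real (Suc n))" if "norm z = 1" for n z
  proof -
    have "2 / real (Suc n) = 2 * (1 / real (Suc n))" by simp
    moreover have "1 / real (Suc n) > 0" by simp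
    ultimately show "0 < Re (p n z) - g n z" "Re (p n z) - g n z \<le> 3 * (1 / real (Suc n))"
      using p(2)[OF that, of n] by linarith+
  qed
  show thesis
  proof (rule that[of p "M + 3"])
    show "p n holomorphic_on UNIV" for n by (rule p(1))
    show "f z < ereal (Re (p n z))" if "norm z = 1" for n z
      using g(2)[of z n] bnd(1)[OF that, of n] that by (auto intro: le_less_trans)
    show "Re (p n z) \<le> M + 3" if z: "norm z = 1" for n z
    proof -
      have "1 / real (Suc n) \<le> 1" by simp
      moreover have "g n z \<le> M" using g(3)[of z n] z by simp
      ultimately show ?thesis using bnd(2)[OF z, of n] by linarith
    qed
    show "(\<lambda>n. ereal (Re (p n z))) \<longlonglongrightarrow> f z" if z: "norm z = 1" for z
    proof -
      have "(\<lambda>n. 3 * (1 / real (Suc n))) \<longlonglongrightarrow> 3 * 0"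
        by (intro tendsto_mult tendsto_const LIMSEQ_Suc[OF lim_1_over_n])
      hence lim3: "(\<lambda>n. 3 * (1 / real (Suc n))) \<longlonglongrightarrow> 0" by simp
      have "(\<lambda>n. Re (p n z) - g n z) \<longlonglongrightarrow> 0"
        by (rule tendsto_sandwich[OF always_eventually always_eventually tendsto_const lim3];
            intro allI less_imp_le[OF bnd(1)[OF z]] bnd(2)[OF z])
      hence "(\<lambda>n. ereal (g n z) + ereal (Re (p n z) - g n z)) \<longlonglongrightarrow> f z + ereal 0"
        using g(4)[of z] z by (intro tendsto_add_ereal_general) auto
      thus ?thesis by simp
    qed
  qed
qed

section \<open>Circle means\<close>

lemma circle_mean_mono:
  assumes "\<And>\<theta>. \<theta> \<in> {0..2 * pi} \<Longrightarrow> f \<theta> \<le> g \<theta>"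
  shows "circle_mean f \<le> circle_mean g"
  unfolding circle_mean_def
proof (rule ereal_divide_right_mono[OF ereal_minus_mono])
  show "enn2ereal (\<integral>\<^sup>+\<theta>\<in>{0..2 * pi}. e2ennreal (f \<theta>) \<partial>lborel) \<le> enn2ereal (\<integral>\<^sup>+\<theta>\<in>{0..2 * pi}. e2ennreal (g \<theta>) \<partial>lborel)"
    using assms by (auto simp flip: less_eq_ennreal.rep_eq intro!: nn_integral_mono e2ennreal_mono split: split_indicator)
  show "enn2ereal (\<integral>\<^sup>+\<theta>\<in>{0..2 * pi}. e2ennreal (- g \<theta>) \<partial>lborel) \<le> enn2ereal (\<integral>\<^sup>+\<theta>\<in>{0..2 * pi}. e2ennreal (- f \<theta>) \<partial>lborel)"
    using assms by (auto simp flip: less_eq_ennreal.rep_eq intro!: nn_integral_mono e2ennreal_mono split: split_indicator)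
qed simp

lemma circle_mean_continuous:
  assumes "continuous_on {0..2 * pi} g"
  shows "circle_mean (\<lambda>\<theta>. ereal (g \<theta>)) = ereal (integral {0..2 * pi} g / (2 * pi))"
proof -
  define G where "G \<theta> = indicator {0..2 * pi} \<theta> * g \<theta>" for \<theta>
  have si: "set_integrable lborel {0..2 * pi} g"
    by (rule borel_integrable_atLeastAtMost'[OF assms])
  hence int: "integrable lborel G" by (simp add: set_integrable_def G_def[abs_def])
  have eq: "(\<integral>\<^sup>+\<theta>\<in>{0..2 * pi}. e2ennreal (ereal (g \<theta>)) \<partial>lborel) = (\<integral>\<^sup>+\<theta>. ennreal (G \<theta>) \<partial>lborel)"
    "(\<integral>\<^sup>+\<theta>\<in>{0..2 * pi}. e2ennreal (- ereal (g \<theta>)) \<partial>lborel) = (\<integral>\<^sup>+\<theta>. ennreal (- G \<theta>) \<partial>lborel)"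
    by (auto intro!: nn_integral_cong simp: G_def split: split_indicator)
  have fin: "(\<integral>\<^sup>+\<theta>. ennreal (G \<theta>) \<partial>lborel) \<noteq> \<infinity>" "(\<integral>\<^sup>+\<theta>. ennreal (- G \<theta>) \<partial>lborel) \<noteq> \<infinity>"
    using int by (auto simp: real_integrable_def)
  have "integral {0..2 * pi} g = (LINT \<theta>|lborel. G \<theta>)"
    using set_borel_integral_eq_integral(2)[OF si] by (simp add: set_lebesgue_integral_def G_def[abs_def])
  also have "\<dots> = enn2real (\<integral>\<^sup>+\<theta>. ennreal (G \<theta>) \<partial>lborel) - enn2real (\<integral>\<^sup>+\<theta>. ennreal (- G \<theta>) \<partial>lborel)"
    by (rule real_lebesgue_integral_def[OF int])
  finally have *: "ereal (integral {0..2 * pi} g) = enn2ereal (\<integral>\<^sup>+\<theta>. ennreal (G \<theta>) \<partial>lborel) - enn2ereal (\<integral>\<^sup>+\<theta>. ennreal (- G \<theta>) \<partial>lborel)"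
    using fin by (cases "\<integral>\<^sup>+\<theta>. ennreal (G \<theta>) \<partial>lborel"; cases "\<integral>\<^sup>+\<theta>. ennreal (- G \<theta>) \<partial>lborel") (auto simp: enn2ereal_ennreal)
  show ?thesis unfolding circle_mean_def eq *[symmetric] by simp
qed

text \<open>
  Cauchy's integral formula at the centre of the disc.
\<close>

lemma circle_mean_Re_holomorphic:
  assumes "continuous_on (cball 0 1) q" "q holomorphic_on ball 0 1"
  shows "circle_mean (\<lambda>\<theta>. ereal (Re (q (cis \<theta>)))) = ereal (Re (q 0))"
proof -
  have "((\<lambda>u. q u / (u - 0)) has_contour_integral (2 * of_real pi * \<i> * q 0)) (part_circlepath 0 1 0 (2 * pi))"
    using Cauchy_integral_circlepath[OF assms, of 0] by (simp add: circlepath_def)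
  hence "((\<lambda>t. \<i> * q (cis t)) has_integral (2 * of_real pi * \<i> * q 0)) {0..2 * pi}"
    by (subst (asm) has_contour_integral_part_circlepath_iff) (auto simp: mult_ac)
  from has_integral_mult_right[OF this, of "- \<i>"]
  have "((\<lambda>t. q (cis t)) has_integral (2 * of_real pi * q 0)) {0..2 * pi}"
    by (simp add: mult.assoc[symmetric]) (simp add: ac_simps)
  from has_integral_linear[OF this bounded_linear_Re]
  have "((\<lambda>t. Re (q (cis t))) has_integral (2 * pi * Re (q 0))) {0..2 * pi}"
    by (simp add: o_def mult.assoc)
  hence "integral {0..2 * pi} (\<lambda>t. Re (q (cis t))) = 2 * pi * Re (q 0)"
    by (rule integral_unique)
  moreover have "continuous_on {0..2 * pi} (\<lambda>t. Re (q (cis t)))"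
    by (intro continuous_intros continuous_on_compose2[OF assms(1)]) auto
  ultimately show ?thesis using circle_mean_continuous by simp
qed

lemma circle_mean_le_Re_holomorphic:
  assumes "continuous_on (cball 0 1) q" "q holomorphic_on ball 0 1"
    and "\<And>z. norm z = 1 \<Longrightarrow> f z \<le> ereal (Re (q z))"
  shows "circle_mean (\<lambda>\<theta>. f (cis \<theta>)) \<le> ereal (Re (q 0))"
  unfolding circle_mean_Re_holomorphic[OF assms(1,2), symmetric]
  by (rule circle_mean_mono) (simp add: assms(3))

text \<open>
  Upper bounds by real parts of entire functions determine the mean of an upper semicontinuous function: for majorants
  \<open>Re (p n)\<close> converging to \<open>f\<close>, the positive parts converge by domination and the negative parts by Fatou's lemma. The
  latter may have the limit \<open>\<infinity>\<close>, in which case \<open>x = -\<infinity>\<close>.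
\<close>

lemma le_circle_meanI:
  fixes f :: "complex \<Rightarrow> ereal"
  assumes usc: "usc_on (sphere 0 1) f" and fin: "\<And>z. norm z = 1 \<Longrightarrow> f z \<noteq> \<infinity>"
    and cert: "\<And>p. p holomorphic_on UNIV \<Longrightarrow> (\<And>z. norm z = 1 \<Longrightarrow> f z < ereal (Re (p z))) \<Longrightarrow> x \<le> ereal (Re (p 0))"
  shows "x \<le> circle_mean (\<lambda>\<theta>. f (cis \<theta>))"
proof -
  obtain p :: "nat \<Rightarrow> complex \<Rightarrow> complex" and M where p:
    "\<And>n. p n holomorphic_on UNIV"
    "\<And>n z. norm z = 1 \<Longrightarrow> f z < ereal (Re (p n z))"
    "\<And>n z. norm z = 1 \<Longrightarrow> Re (p n z) \<le> M"
    "\<And>z. norm z = 1 \<Longrightarrow> (\<lambda>n. ereal (Re (p n z))) \<longlonglongrightarrow> f z"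
    using usc_on_circle_entire_approx[OF usc fin] by blast
  let ?I = "{0..2 * pi}"
  let ?A = "\<lambda>n. \<integral>\<^sup>+\<theta>\<in>?I. e2ennreal (ereal (Re (p n (cis \<theta>)))) \<partial>lborel"
  let ?B = "\<lambda>n. \<integral>\<^sup>+\<theta>\<in>?I. e2ennreal (- ereal (Re (p n (cis \<theta>)))) \<partial>lborel"
  let ?A' = "\<integral>\<^sup>+\<theta>\<in>?I. e2ennreal (f (cis \<theta>)) \<partial>lborel"
  let ?B' = "\<integral>\<^sup>+\<theta>\<in>?I. e2ennreal (- f (cis \<theta>)) \<partial>lborel"
  have pm [measurable]: "(\<lambda>\<theta>. Re (p n (cis \<theta>))) \<in> borel_measurable borel" for n
  proof -
    have "continuous_on UNIV (\<lambda>\<theta>. p n (cis \<theta>))"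
      by (rule continuous_on_compose2[OF holomorphic_on_imp_continuous_on[OF p(1)]])
         (rule continuous_on_cis[OF continuous_on_id], simp)
    thus ?thesis by (intro borel_measurable_continuous_onI continuous_on_Re)
  qed
  have limf: "(\<lambda>n. ereal (Re (p n (cis \<theta>)))) \<longlonglongrightarrow> f (cis \<theta>)" for \<theta> by (rule p(4)) simp
  have fm [measurable]: "(\<lambda>\<theta>. f (cis \<theta>)) \<in> borel_measurable borel"
    by (rule borel_measurable_LIMSEQ_order[OF limf]) simp
  have "?A \<longlonglongrightarrow> ?A'"
  proof (rule nn_integral_dominated_convergence[where w = "\<lambda>\<theta>. ennreal M * indicator ?I \<theta>"])
    have "(\<integral>\<^sup>+\<theta>. ennreal M * indicator ?I \<theta> \<partial>lborel) = ennreal M * emeasure lborel ?I"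
      by (rule nn_integral_cmult_indicator) simp
    also have "\<dots> < \<infinity>" by (simp add: ennreal_mult_less_top)
    finally show "(\<integral>\<^sup>+\<theta>. ennreal M * indicator ?I \<theta> \<partial>lborel) < \<infinity>" .
    show "AE \<theta> in lborel. e2ennreal (ereal (Re (p n (cis \<theta>)))) * indicator ?I \<theta> \<le> ennreal M * indicator ?I \<theta>" for n
      using p(3) by (intro AE_I2) (auto split: split_indicator intro!: ennreal_leI)
    show "AE \<theta> in lborel. (\<lambda>n. e2ennreal (ereal (Re (p n (cis \<theta>)))) * indicator ?I \<theta>) \<longlonglongrightarrow> e2ennreal (f (cis \<theta>)) * indicator ?I \<theta>"
      by (intro AE_I2) (auto split: split_indicator simp del: e2ennreal_ereal intro!: tendsto_e2ennrealI limf)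
  qed measurable
  hence limA: "(\<lambda>n. enn2ereal (?A n)) \<longlonglongrightarrow> enn2ereal ?A'"
    by (intro tendsto_enn2erealI)
  have A'fin: "?A' \<noteq> \<infinity>"
  proof -
    have "?A' \<le> (\<integral>\<^sup>+\<theta>. ennreal M * indicator ?I \<theta> \<partial>lborel)"
    proof (rule nn_integral_mono)
      fix \<theta> :: real
      have "f (cis \<theta>) \<le> ereal (Re (p 0 (cis \<theta>)))"
        by (rule less_imp_le[OF p(2)]) simp
      also have "\<dots> \<le> ereal M" using p(3)[of "cis \<theta>" 0] by simp
      finally have "f (cis \<theta>) \<le> ereal M" .
      from e2ennreal_mono[OF this]
      show "e2ennreal (f (cis \<theta>)) * indicator ?I \<theta> \<le> ennreal M * indicator ?I \<theta>"
        by (auto split: split_indicator)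
    qed
    also have "\<dots> = ennreal M * emeasure lborel ?I"
      by (rule nn_integral_cmult_indicator) simp
    also have "\<dots> < \<infinity>" by (simp add: ennreal_mult_less_top)
    finally show ?thesis by simp
  qed
  have "?B' = (\<integral>\<^sup>+\<theta>. liminf (\<lambda>n. e2ennreal (- ereal (Re (p n (cis \<theta>)))) * indicator ?I \<theta>) \<partial>lborel)"
  proof (rule nn_integral_cong)
    fix \<theta> :: real
    have "(\<lambda>n. e2ennreal (- ereal (Re (p n (cis \<theta>)))) * indicator ?I \<theta>) \<longlonglongrightarrow> e2ennreal (- f (cis \<theta>)) * indicator ?I \<theta>"
      by (auto split: split_indicator simp del: e2ennreal_ereal uminus_ereal.simps intro!: tendsto_e2ennrealI tendsto_uminus_ereal limf)
    thus "e2ennreal (- f (cis \<theta>)) * indicator ?I \<theta> = liminf (\<lambda>n. e2ennreal (- ereal (Re (p n (cis \<theta>)))) * indicator ?I \<theta>)"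
      by (simp add: lim_imp_Liminf)
  qed
  also have "\<dots> \<le> liminf ?B" by (rule nn_integral_liminf) measurable
  finally have B'le: "?B' \<le> liminf ?B" .
  have Bn: "?B n \<le> ?B'" for n
  proof (rule nn_integral_mono)
    fix \<theta> :: real
    have "- ereal (Re (p n (cis \<theta>))) \<le> - f (cis \<theta>)"
      unfolding ereal_minus_le_minus by (rule less_imp_le[OF p(2)]) simp
    from e2ennreal_mono[OF this]
    show "e2ennreal (- ereal (Re (p n (cis \<theta>)))) * indicator ?I \<theta> \<le> e2ennreal (- f (cis \<theta>)) * indicator ?I \<theta>"
      by (auto split: split_indicator)
  qed
  have ls: "limsup ?B \<le> ?B'" by (intro Limsup_bounded always_eventually allI Bn)
  have ll: "liminf ?B \<le> limsup ?B" by (rule Liminf_le_Limsup) simp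
  have "?B \<longlonglongrightarrow> ?B'"
    by (rule Liminf_eq_Limsup[OF _ order.antisym[OF order.trans[OF ll ls] B'le] order.antisym[OF ls order.trans[OF B'le ll]]]) simp
  hence limB: "(\<lambda>n. enn2ereal (?B n)) \<longlonglongrightarrow> enn2ereal ?B'"
    by (intro tendsto_enn2erealI)
  have lim: "(\<lambda>n. (enn2ereal (?A n) - enn2ereal (?B n)) / ereal (2 * pi)) \<longlonglongrightarrow> (enn2ereal ?A' - enn2ereal ?B') / ereal (2 * pi)"
    using A'fin by (intro tendsto_divide_ereal tendsto_diff_ereal_general limA limB tendsto_const)
       (auto simp: enn2ereal_eq_top_iff)
  have le: "x \<le> (enn2ereal (?A n) - enn2ereal (?B n)) / ereal (2 * pi)" for n
  proof -
    have "x \<le> ereal (Re (p n 0))" using p(1,2) by (intro cert) auto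
    also have "\<dots> = circle_mean (\<lambda>\<theta>. ereal (Re (p n (cis \<theta>))))"
      using holomorphic_on_subset[OF p(1)[of n]] holomorphic_on_imp_continuous_on
      by (intro circle_mean_Re_holomorphic[symmetric]) auto
    finally show ?thesis by (simp only: circle_mean_def)
  qed
  show ?thesis unfolding circle_mean_def using le by (intro LIMSEQ_le_const[OF lim]) blast
qed

section \<open>The maximum principle and locality of plurisubharmonicity\<close>

text \<open>
  If \<open>v - h\<close> is positive somewhere, then \<open>v - h + \<epsilon> \<bar>z\<bar>\<^sup>2\<close> with a small \<open>\<epsilon>\<close> has its maximum at a point \<open>w\<close> where
  \<open>v w > h w\<close>. On a circle of radius \<open>s\<close> about \<open>w\<close>, the function \<open>\<bar>z\<bar>\<^sup>2\<close> is \<open>\<bar>w\<bar>\<^sup>2 + s\<^sup>2\<close> plus the real part of a linear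
  function, so maximality bounds \<open>v\<close> there by \<open>h\<close> plus an affine term, and the value of the bound at \<open>w\<close> is smaller than \<open>v w\<close>
  by \<open>\<epsilon> s\<^sup>2\<close>. For this reason a sub-mean value property tested against affine perturbations of \<open>h\<close> on one circle about each point
  is enough.
\<close>

lemma maximum_principle:
  fixes v :: "complex \<Rightarrow> ereal" and h :: "complex \<Rightarrow> real"
  assumes S: "compact S" and usc: "usc_on S v" and fin: "\<And>w. w \<in> S \<Longrightarrow> v w \<noteq> \<infinity>"
    and cont: "continuous_on S h"
    and step: "\<And>w. w \<in> S \<Longrightarrow> v w \<le> ereal (h w) \<or>
      (\<exists>s>0. (\<forall>\<zeta>. norm \<zeta> = 1 \<longrightarrow> w + of_real s * \<zeta> \<in> S) \<and>
        (\<forall>b c. (\<forall>\<zeta>. norm \<zeta> = 1 \<longrightarrow> v (w + of_real s * \<zeta>) \<le> ereal (h (w + of_real s * \<zeta>) + Re (b * \<zeta>) + c))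
           \<longrightarrow> v w \<le> ereal (h w + c)))"
    and w0: "w0 \<in> S"
  shows "v w0 \<le> ereal (h w0)"
proof (rule ccontr)
  assume "\<not> v w0 \<le> ereal (h w0)"
  hence "v w0 > ereal (h w0)" by simp
  then obtain r where r: "ereal (h w0) < ereal r" "ereal r < v w0" using ereal_dense2 by blast
  define \<delta> where "\<delta> = r - h w0"
  have \<delta>: "\<delta> > 0" "ereal (h w0 + \<delta>) < v w0" using r by (auto simp: \<delta>_def)
  obtain B where B: "\<And>z. z \<in> S \<Longrightarrow> norm z \<le> B"
    using compact_imp_bounded[OF S] unfolding bounded_iff by blast
  define \<epsilon> where "\<epsilon> = \<delta> / (B\<^sup>2 + 1)"
  have B1: "B\<^sup>2 + 1 > 0" by (simp add: add_nonneg_pos)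
  have \<epsilon>: "\<epsilon> > 0" using \<delta> B1 by (simp add: \<epsilon>_def)
  have "\<epsilon> * (B\<^sup>2 + 1) = \<delta>" using B1 by (simp add: \<epsilon>_def)
  hence \<epsilon>B: "\<epsilon> * B\<^sup>2 < \<delta>" using \<epsilon> by (simp add: algebra_simps)
  define k where "k z = \<epsilon> * (norm z)\<^sup>2 - h z" for z
  have "continuous_on S k" unfolding k_def by (intro continuous_intros cont)
  hence "usc_on S (\<lambda>z. v z + ereal (k z))" by (rule usc_on_add_continuous[OF usc])
  then obtain m where m: "m \<in> S" "\<And>y. y \<in> S \<Longrightarrow> v y + ereal (k y) \<le> v m + ereal (k m)"
    using usc_on_attains_max[OF S] w0 by blast
  have "ereal \<delta> < v w0 + ereal (k w0)"
  proof -
    have "\<epsilon> * (norm w0)\<^sup>2 \<ge> 0" using \<epsilon> by simp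
    thus ?thesis using \<delta>(2) unfolding k_def by (cases "v w0") auto
  qed
  also have "\<dots> \<le> v m + ereal (k m)" by (rule m(2)[OF w0])
  finally have big: "ereal \<delta> < v m + ereal (k m)" .
  then obtain x where x: "v m = ereal x" using fin[OF m(1)] by (cases "v m") auto
  have nm: "\<epsilon> * (norm m)\<^sup>2 \<le> \<epsilon> * B\<^sup>2" using \<epsilon> B[OF m(1)] by (intro mult_left_mono power_mono) auto
  from step[OF m(1)] show False
  proof
    assume "v m \<le> ereal (h m)"
    thus False using big nm \<epsilon>B unfolding x k_def by simp
  next
    assume "\<exists>s>0. (\<forall>\<zeta>. norm \<zeta> = 1 \<longrightarrow> m + of_real s * \<zeta> \<in> S) \<and>
        (\<forall>b c. (\<forall>\<zeta>. norm \<zeta> = 1 \<longrightarrow> v (m + of_real s * \<zeta>) \<le> ereal (h (m + of_real s * \<zeta>) + Re (b * \<zeta>) + c))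
           \<longrightarrow> v m \<le> ereal (h m + c))"
    then obtain s where s: "s > 0" "\<And>\<zeta>. norm \<zeta> = 1 \<Longrightarrow> m + of_real s * \<zeta> \<in> S"
      "\<And>b c. (\<And>\<zeta>. norm \<zeta> = 1 \<Longrightarrow> v (m + of_real s * \<zeta>) \<le> ereal (h (m + of_real s * \<zeta>) + Re (b * \<zeta>) + c))
           \<Longrightarrow> v m \<le> ereal (h m + c)" by blast
    \<comment> \<open>Here \<open>x\<close> is \<open>v m\<close>, so the bound is impossible: it falls short of \<open>v m\<close> by \<open>\<epsilon> * s\<^sup>2\<close>.\<close>
    have "v m \<le> ereal (h m + (x - h m - \<epsilon> * s\<^sup>2))"
    proof (rule s(3)[of "- 2 * \<epsilon> * s * cnj m"])
      fix \<zeta> :: complex assume \<zeta>: "norm \<zeta> = 1"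
      let ?y = "m + of_real s * \<zeta>"
      have "(norm ?y)\<^sup>2 = (norm m)\<^sup>2 + s\<^sup>2 + 2 * s * Re (cnj m * \<zeta>)"
      proof -
        have "(norm \<zeta>)\<^sup>2 = 1" using \<zeta> by simp
        hence "(Re \<zeta>)\<^sup>2 + (Im \<zeta>)\<^sup>2 = 1" by (simp add: cmod_power2)
        hence "s\<^sup>2 * ((Re \<zeta>)\<^sup>2 + (Im \<zeta>)\<^sup>2) = s\<^sup>2" by simp
        thus ?thesis unfolding cmod_power2 by (simp add: power2_eq_square algebra_simps)
      qed
      hence ny: "\<epsilon> * (norm ?y)\<^sup>2 = \<epsilon> * (norm m)\<^sup>2 + \<epsilon> * s\<^sup>2 + 2 * \<epsilon> * s * Re (cnj m * \<zeta>)"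
        by (simp add: algebra_simps)
      have "v ?y + ereal (k ?y) \<le> ereal (x + k m)" using m(2)[OF s(2)[OF \<zeta>]] unfolding x by simp
      hence "v ?y \<le> ereal (x + k m - k ?y)" by (cases "v ?y") auto
      also have "x + k m - k ?y = h ?y + Re (- 2 * \<epsilon> * s * cnj m * \<zeta>) + (x - h m - \<epsilon> * s\<^sup>2)"
        unfolding k_def ny by (simp add: algebra_simps)
      finally show "v ?y \<le> ereal (h ?y + Re (- 2 * \<epsilon> * s * cnj m * \<zeta>) + (x - h m - \<epsilon> * s\<^sup>2))" .
    qed
    hence "\<epsilon> * s\<^sup>2 \<le> 0" unfolding x by simp
    thus False using \<epsilon> s(1) by (simp add: mult_le_0_iff)
  qed
qed

lemma norm_vector_scalar_mult: "norm (\<zeta> *s b) = norm \<zeta> * norm (b :: complex ^ 'n)"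
  by (simp add: norm_vec_def norm_mult L2_set_right_distrib)

lemma continuous_on_complex_line [continuous_intros]:
  "continuous_on S f \<Longrightarrow> continuous_on S (\<lambda>\<zeta>. z + f \<zeta> *s (b :: complex ^ 'n))"
  unfolding vector_scalar_mult_def by (intro continuous_intros)

lemma psh_on_usc: "psh_on \<Omega> u \<Longrightarrow> usc_on \<Omega> u"
  by (simp add: psh_on_def usc_on_open_iff)

lemma psh_on_open: "psh_on \<Omega> u \<Longrightarrow> open \<Omega>"
  by (simp add: psh_on_def)

lemma psh_on_finite: "psh_on \<Omega> u \<Longrightarrow> z \<in> \<Omega> \<Longrightarrow> u z \<noteq> \<infinity>"
  by (simp add: psh_on_def)

lemma usc_on_complex_line:
  fixes b :: "complex ^ 'n"
  assumes "usc_on \<Omega> u" "\<And>\<zeta>. \<zeta> \<in> S \<Longrightarrow> z + \<zeta> *s b \<in> \<Omega>"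
  shows "usc_on S (\<lambda>\<zeta>. u (z + \<zeta> *s b))"
  by (rule usc_on_compose[OF assms(1)]) (use assms(2) in \<open>auto intro!: continuous_intros\<close>)

lemma psh_on_le_Re_holomorphic:
  assumes "psh_on \<Omega> u" "\<And>\<zeta>. norm \<zeta> \<le> 1 \<Longrightarrow> z + \<zeta> *s b \<in> \<Omega>"
    and "continuous_on (cball 0 1) q" "q holomorphic_on ball 0 1"
    and "\<And>\<zeta>. norm \<zeta> = 1 \<Longrightarrow> u (z + \<zeta> *s b) \<le> ereal (Re (q \<zeta>))"
  shows "u z \<le> ereal (Re (q 0))"
proof -
  have "u z \<le> circle_mean (\<lambda>\<theta>. u (z + cis \<theta> *s b))"
    using assms(1,2) unfolding psh_on_def by blast
  also have "\<dots> \<le> ereal (Re (q 0))"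
    using circle_mean_le_Re_holomorphic[OF assms(3,4), of "\<lambda>\<zeta>. u (z + \<zeta> *s b)"] assms(5) by blast
  finally show ?thesis .
qed

text \<open>
  The converse of \<open>psh_on_le_Re_holomorphic\<close>: the sub-mean value inequality only has to be tested against real parts of entire
  functions.
\<close>

lemma psh_onI:
  assumes "open \<Omega>" "\<And>z. z \<in> \<Omega> \<Longrightarrow> u z \<noteq> \<infinity>" "usc_on \<Omega> u"
    and "\<And>z b q. \<lbrakk>\<And>\<zeta>. norm \<zeta> \<le> 1 \<Longrightarrow> z + \<zeta> *s b \<in> \<Omega>; q holomorphic_on UNIV;
          \<And>\<zeta>. norm \<zeta> = 1 \<Longrightarrow> u (z + \<zeta> *s b) < ereal (Re (q \<zeta>))\<rbrakk> \<Longrightarrow> u z \<le> ereal (Re (q 0))"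
  shows "psh_on \<Omega> u"
  unfolding psh_on_def
proof (intro conjI allI impI ballI)
  fix z b assume disc: "\<forall>\<zeta>. norm \<zeta> \<le> 1 \<longrightarrow> z + \<zeta> *s b \<in> \<Omega>"
  show "u z \<le> circle_mean (\<lambda>\<theta>. u (z + cis \<theta> *s b))"
  proof (rule le_circle_meanI[of "\<lambda>\<zeta>. u (z + \<zeta> *s b)"])
    show "usc_on (sphere 0 1) (\<lambda>\<zeta>. u (z + \<zeta> *s b))"
      using disc by (intro usc_on_complex_line[OF assms(3)]) auto
    show "u (z + \<zeta> *s b) \<noteq> \<infinity>" if "norm \<zeta> = 1" for \<zeta>
      using disc that by (intro assms(2)) simp
    show "u z \<le> ereal (Re (p 0))" if "p holomorphic_on UNIV"
      "\<And>\<zeta>. norm \<zeta> = 1 \<Longrightarrow> u (z + \<zeta> *s b) < ereal (Re (p \<zeta>))" for p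
      using disc by (intro assms(4)[OF _ that]) simp_all
  qed
qed (use assms(1-3) usc_on_open_iff in auto)

text \<open>
  A closed disc in the union need not lie in either set, but small discs about its points do. The maximum principle on the disc
  extends the comparison of \<open>u\<close> with \<open>Re q\<close> from these to the whole disc.
\<close>

lemma psh_on_Un:
  assumes u1: "psh_on \<Omega>\<^sub>1 u" and u2: "psh_on \<Omega>\<^sub>2 u"
  shows "psh_on (\<Omega>\<^sub>1 \<union> \<Omega>\<^sub>2) u"
proof (rule psh_onI)
  show "open (\<Omega>\<^sub>1 \<union> \<Omega>\<^sub>2)" using assms psh_on_open by blast
  have "{x \<in> \<Omega>\<^sub>1 \<union> \<Omega>\<^sub>2. u x < t} = {x \<in> \<Omega>\<^sub>1. u x < t} \<union> {x \<in> \<Omega>\<^sub>2. u x < t}" for t by auto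
  thus usc: "usc_on (\<Omega>\<^sub>1 \<union> \<Omega>\<^sub>2) u"
    using assms by (simp add: psh_on_def usc_on_open_iff open_Un)
  show fin: "u z \<noteq> \<infinity>" if "z \<in> \<Omega>\<^sub>1 \<union> \<Omega>\<^sub>2" for z using that assms psh_on_finite by blast
  fix z b q
  assume disc: "\<And>\<zeta>. norm \<zeta> \<le> 1 \<Longrightarrow> z + \<zeta> *s b \<in> \<Omega>\<^sub>1 \<union> \<Omega>\<^sub>2"
    and q: "q holomorphic_on UNIV"
    and less: "\<And>\<zeta>. norm \<zeta> = 1 \<Longrightarrow> u (z + \<zeta> *s b) < ereal (Re (q \<zeta>))"
  have line: "z + w *s b + \<zeta> *s (of_real s *s b) = z + (w + of_real s * \<zeta>) *s b" for w \<zeta> s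
    by (simp add: vec_eq_iff algebra_simps)
  have "u (z + 0 *s b) \<le> ereal (Re (q 0))"
  proof (rule maximum_principle[of "cball 0 1" "\<lambda>\<zeta>. u (z + \<zeta> *s b)" "\<lambda>\<zeta>. Re (q \<zeta>)" 0])
    show "usc_on (cball 0 1) (\<lambda>\<zeta>. u (z + \<zeta> *s b))"
      using disc by (intro usc_on_complex_line[OF usc]) auto
    show "continuous_on (cball 0 1) (\<lambda>\<zeta>. Re (q \<zeta>))"
      by (intro continuous_on_Re holomorphic_on_imp_continuous_on holomorphic_on_subset[OF q]) simp
    fix w :: complex assume w: "w \<in> cball 0 1"
    show "u (z + w *s b) \<le> ereal (Re (q w)) \<or>
      (\<exists>s>0. (\<forall>\<zeta>. norm \<zeta> = 1 \<longrightarrow> w + of_real s * \<zeta> \<in> cball 0 1) \<and>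
        (\<forall>b' c. (\<forall>\<zeta>. norm \<zeta> = 1 \<longrightarrow> u (z + (w + of_real s * \<zeta>) *s b) \<le> ereal (Re (q (w + of_real s * \<zeta>)) + Re (b' * \<zeta>) + c))
           \<longrightarrow> u (z + w *s b) \<le> ereal (Re (q w) + c)))"
    proof (cases "norm w = 1")
      case True
      thus ?thesis using less[OF True] by (auto intro: less_imp_le)
    next
      case False
      hence nw: "norm w < 1" using w by simp
      obtain \<Omega> where \<Omega>: "psh_on \<Omega> u" "z + w *s b \<in> \<Omega>"
        using disc[of w] nw u1 u2 by auto
      have "open ((\<lambda>\<zeta>. z + \<zeta> *s b) -` \<Omega>)"
        by (intro open_vimage psh_on_open[OF \<Omega>(1)] continuous_intros)
      then obtain e where e: "e > 0" "ball w e \<subseteq> (\<lambda>\<zeta>. z + \<zeta> *s b) -` \<Omega>"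
        using \<Omega>(2) by (meson open_contains_ball vimageI)
      define s where "s = min (e / 2) (1 - norm w)"
      have s: "s > 0" "s < e" "s \<le> 1 - norm w" using e(1) nw by (auto simp: s_def)
      have nle: "norm (w + of_real s * \<zeta>) \<le> 1" if "norm \<zeta> = 1" for \<zeta> :: complex
      proof -
        have "norm (w + of_real s * \<zeta>) \<le> norm w + norm (of_real s * \<zeta>)" by (rule norm_triangle_ineq)
        thus ?thesis using s that by (simp add: norm_mult)
      qed
      have "u (z + w *s b) \<le> ereal (Re (q w) + c)"
        if *: "\<And>\<zeta>. norm \<zeta> = 1 \<Longrightarrow> u (z + (w + of_real s * \<zeta>) *s b) \<le> ereal (Re (q (w + of_real s * \<zeta>)) + Re (b' * \<zeta>) + c)"
        for b' c
      proof -
        have hol: "(\<lambda>\<zeta>. q (w + of_real s * \<zeta>) + b' * \<zeta> + of_real c) holomorphic_on UNIV"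
        proof -
          have "(\<lambda>\<zeta>. w + of_real s * \<zeta>) holomorphic_on UNIV" by (intro holomorphic_intros)
          hence "(\<lambda>\<zeta>. q (w + of_real s * \<zeta>)) holomorphic_on UNIV"
            using holomorphic_on_compose_gen[OF _ q] by (auto simp: o_def)
          thus ?thesis by (intro holomorphic_intros)
        qed
        have "u (z + w *s b) \<le> ereal (Re (q (w + of_real s * 0) + b' * 0 + of_real c))"
        proof (rule psh_on_le_Re_holomorphic[OF \<Omega>(1), of "z + w *s b" "of_real s *s b" "\<lambda>\<zeta>. q (w + of_real s * \<zeta>) + b' * \<zeta> + of_real c"])
          fix \<zeta> :: complex assume "norm \<zeta> \<le> 1"
          hence "s * norm \<zeta> \<le> s * 1" using s(1) by (intro mult_left_mono) auto
          hence "s * norm \<zeta> < e" using s(2) by linarith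
          hence "w + of_real s * \<zeta> \<in> ball w e" using s by (simp add: dist_norm norm_mult)
          thus "z + w *s b + \<zeta> *s (of_real s *s b) \<in> \<Omega>" unfolding line using e(2) by auto
        next
          fix \<zeta> :: complex assume "norm \<zeta> = 1"
          thus "u (z + w *s b + \<zeta> *s (of_real s *s b)) \<le> ereal (Re (q (w + of_real s * \<zeta>) + b' * \<zeta> + of_real c))"
            unfolding line using *[of \<zeta>] by simp
        qed (auto intro: holomorphic_on_subset[OF hol] holomorphic_on_imp_continuous_on)
        thus ?thesis by simp
      qed
      thus ?thesis using s(1) nle by (intro disjI2 exI[of _ s]) auto
    qed
  qed (use disc fin in auto)
  thus "u z \<le> ereal (Re (q 0))" by simp
qed

section \<open>Operations on plurisubharmonic functions\<close>

lemma psh_on_const: "open \<Omega> \<Longrightarrow> psh_on \<Omega> (\<lambda>_. ereal c)"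
proof -
  assume o: "open \<Omega>"
  have "open {z \<in> \<Omega>. ereal c < t}" for t using o by (cases "ereal c < t") simp_all
  thus "psh_on \<Omega> (\<lambda>_. ereal c)"
    using o circle_mean_continuous[of "\<lambda>_. c"] by (simp add: psh_on_def)
qed

lemma entire_on_unit_disc:
  "q holomorphic_on UNIV \<Longrightarrow> continuous_on (cball 0 1) q"
  "q holomorphic_on UNIV \<Longrightarrow> q holomorphic_on ball 0 1"
  by (auto intro: holomorphic_on_subset holomorphic_on_imp_continuous_on)

lemma psh_on_subset:
  assumes u: "psh_on \<Omega> u" and sub: "\<Omega>' \<subseteq> \<Omega>" and o: "open \<Omega>'"
  shows "psh_on \<Omega>' u"
proof (rule psh_onI[OF o])
  show "u z \<noteq> \<infinity>" if "z \<in> \<Omega>'" for z using psh_on_finite[OF u] sub that by blast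
  show "usc_on \<Omega>' u" by (rule usc_on_subset[OF psh_on_usc[OF u] sub])
next
  fix z b q
  assume disc: "\<And>\<zeta>. norm \<zeta> \<le> 1 \<Longrightarrow> z + \<zeta> *s b \<in> \<Omega>'" and q: "q holomorphic_on UNIV"
    and less: "\<And>\<zeta>. norm \<zeta> = 1 \<Longrightarrow> u (z + \<zeta> *s b) < ereal (Re (q \<zeta>))"
  show "u z \<le> ereal (Re (q 0))"
    by (rule psh_on_le_Re_holomorphic[OF u subsetD[OF sub disc] entire_on_unit_disc[OF q] less_imp_le[OF less]])
qed

lemma psh_on_cong:
  assumes u: "psh_on \<Omega> u" and eq: "\<And>z. z \<in> \<Omega> \<Longrightarrow> v z = u z"
  shows "psh_on \<Omega> v"
proof (rule psh_onI[OF psh_on_open[OF u]])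
  show "v z \<noteq> \<infinity>" if "z \<in> \<Omega>" for z using psh_on_finite[OF u that] eq[OF that] by simp
  have "{z \<in> \<Omega>. v z < t} = {z \<in> \<Omega>. u z < t}" for t using eq by auto
  thus "usc_on \<Omega> v" using psh_on_usc[OF u] by (simp add: usc_on_def)
next
  fix z b q
  assume disc: "\<And>\<zeta>. norm \<zeta> \<le> 1 \<Longrightarrow> z + \<zeta> *s b \<in> \<Omega>" and q: "q holomorphic_on UNIV"
    and less: "\<And>\<zeta>. norm \<zeta> = 1 \<Longrightarrow> v (z + \<zeta> *s b) < ereal (Re (q \<zeta>))"
  have "u z \<le> ereal (Re (q 0))"
  proof (rule psh_on_le_Re_holomorphic[OF u disc entire_on_unit_disc[OF q]])
    show "u (z + \<zeta> *s b) \<le> ereal (Re (q \<zeta>))" if "norm \<zeta> = 1" for \<zeta>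
      using less[OF that] disc[of \<zeta>] that by (simp add: eq less_imp_le)
  qed
  moreover have "z \<in> \<Omega>" using disc[of 0] by simp
  ultimately show "v z \<le> ereal (Re (q 0))" by (simp add: eq)
qed

lemma psh_on_max:
  assumes u: "psh_on \<Omega> u" and v: "psh_on \<Omega> v"
  shows "psh_on \<Omega> (\<lambda>z. max (u z) (v z))"
proof (rule psh_onI[OF psh_on_open[OF u]])
  show "max (u z) (v z) \<noteq> \<infinity>" if "z \<in> \<Omega>" for z
    using psh_on_finite[OF u that] psh_on_finite[OF v that] by (simp add: max_def)
  have "{z \<in> \<Omega>. max (u z) (v z) < t} = {z \<in> \<Omega>. u z < t} \<inter> {z \<in> \<Omega>. v z < t}" for t by auto
  thus "usc_on \<Omega> (\<lambda>z. max (u z) (v z))"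
    using psh_on_usc[OF u] psh_on_usc[OF v] by (simp add: usc_on_def openin_Int)
next
  fix z b q
  assume disc: "\<And>\<zeta>. norm \<zeta> \<le> 1 \<Longrightarrow> z + \<zeta> *s b \<in> \<Omega>" and q: "q holomorphic_on UNIV"
    and less: "\<And>\<zeta>. norm \<zeta> = 1 \<Longrightarrow> max (u (z + \<zeta> *s b)) (v (z + \<zeta> *s b)) < ereal (Re (q \<zeta>))"
  have "u z \<le> ereal (Re (q 0))"
    by (rule psh_on_le_Re_holomorphic[OF u disc entire_on_unit_disc[OF q] less_imp_le])
       (use less in simp_all)
  moreover have "v z \<le> ereal (Re (q 0))"
    by (rule psh_on_le_Re_holomorphic[OF v disc entire_on_unit_disc[OF q] less_imp_le])
       (use less in simp_all)
  ultimately show "max (u z) (v z) \<le> ereal (Re (q 0))" by simp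
qed

lemma ereal_affine_less_iff:
  assumes "\<alpha> > 0"
  shows "ereal \<alpha> * x + ereal \<beta> < ereal t \<longleftrightarrow> x < ereal ((t - \<beta>) / \<alpha>)"
  using assms by (cases x) (auto simp: field_simps)

lemma ereal_affine_le_iff:
  assumes "\<alpha> > 0"
  shows "ereal \<alpha> * x + ereal \<beta> \<le> ereal t \<longleftrightarrow> x \<le> ereal ((t - \<beta>) / \<alpha>)"
  using assms by (cases x) (auto simp: field_simps)

lemma psh_on_affine:
  assumes u: "psh_on \<Omega> u" and \<alpha>: "\<alpha> > 0"
  shows "psh_on \<Omega> (\<lambda>z. ereal \<alpha> * u z + ereal \<beta>)"
proof (rule psh_onI[OF psh_on_open[OF u]])
  show fin: "ereal \<alpha> * u z + ereal \<beta> \<noteq> \<infinity>" if "z \<in> \<Omega>" for z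
    using psh_on_finite[OF u that] \<alpha> by (cases "u z") auto
  show "usc_on \<Omega> (\<lambda>z. ereal \<alpha> * u z + ereal \<beta>)"
    unfolding usc_on_def
  proof
    fix t
    have *: "openin (top_of_set \<Omega>) {z \<in> \<Omega>. u z < t}" for t
      using psh_on_usc[OF u] by (simp add: usc_on_def)
    show "openin (top_of_set \<Omega>) {z \<in> \<Omega>. ereal \<alpha> * u z + ereal \<beta> < t}"
    proof (cases t)
      case (real r)
      thus ?thesis using * by (simp add: ereal_affine_less_iff[OF \<alpha>])
    next
      case PInf
      hence "{z \<in> \<Omega>. ereal \<alpha> * u z + ereal \<beta> < t} = \<Omega>" using fin by auto
      thus ?thesis by simp
    qed simp
  qed
next
  fix z b q
  assume disc: "\<And>\<zeta>. norm \<zeta> \<le> 1 \<Longrightarrow> z + \<zeta> *s b \<in> \<Omega>" and q: "q holomorphic_on UNIV"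
    and less: "\<And>\<zeta>. norm \<zeta> = 1 \<Longrightarrow> ereal \<alpha> * u (z + \<zeta> *s b) + ereal \<beta> < ereal (Re (q \<zeta>))"
  have hol: "(\<lambda>\<zeta>. (q \<zeta> - of_real \<beta>) / of_real \<alpha>) holomorphic_on UNIV"
    using \<alpha> by (intro holomorphic_intros q) auto
  have Re: "Re ((q \<zeta> - of_real \<beta>) / of_real \<alpha>) = (Re (q \<zeta>) - \<beta>) / \<alpha>" for \<zeta>
    by simp
  have "u z \<le> ereal (Re ((q 0 - of_real \<beta>) / of_real \<alpha>))"
    by (rule psh_on_le_Re_holomorphic[OF u disc entire_on_unit_disc[OF hol]])
       (use less in \<open>auto intro: less_imp_le simp: Re ereal_affine_less_iff[OF \<alpha>] simp del: Re_divide_of_real\<close>)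
  thus "ereal \<alpha> * u z + ereal \<beta> \<le> ereal (Re (q 0))"
    unfolding Re ereal_affine_le_iff[OF \<alpha>] .
qed

text \<open>
  Since \<open>f\<close> is continuous, it lies within \<open>\<epsilon>/2\<close> of some \<open>Re p\<close> on the circle. Then \<open>u + f < Re q\<close> separates into bounds for \<open>f\<close>
  by \<open>Re p\<close> and for \<open>u\<close> by \<open>Re (q - p)\<close>, up to \<open>\<epsilon>\<close>.
\<close>

lemma psh_on_add_continuous:
  assumes u: "psh_on \<Omega> u" and f: "psh_on \<Omega> (\<lambda>z. ereal (f z))" and cont: "continuous_on \<Omega> f"
  shows "psh_on \<Omega> (\<lambda>z. u z + ereal (f z))"
proof (rule psh_onI[OF psh_on_open[OF u]])
  show "u z + ereal (f z) \<noteq> \<infinity>" if "z \<in> \<Omega>" for z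
    using psh_on_finite[OF u that] by simp
  show "usc_on \<Omega> (\<lambda>z. u z + ereal (f z))"
    by (rule usc_on_add_continuous[OF psh_on_usc[OF u] cont])
next
  fix z b q
  assume disc: "\<And>\<zeta>. norm \<zeta> \<le> 1 \<Longrightarrow> z + \<zeta> *s b \<in> \<Omega>" and q: "q holomorphic_on UNIV"
    and less: "\<And>\<zeta>. norm \<zeta> = 1 \<Longrightarrow> u (z + \<zeta> *s b) + ereal (f (z + \<zeta> *s b)) < ereal (Re (q \<zeta>))"
  have cf: "continuous_on (sphere 0 1) (\<lambda>\<zeta>. f (z + \<zeta> *s b))"
    using disc by (intro continuous_on_compose2[OF cont] continuous_intros) auto
  show "u z + ereal (f z) \<le> ereal (Re (q 0))"
  proof (rule ereal_le_epsilon2)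
      fix e :: real assume "0 < e"
      hence e2: "e / 2 > 0" by simp
      obtain p where p: "p holomorphic_on UNIV" "\<And>\<zeta>. norm \<zeta> = 1 \<Longrightarrow> \<bar>f (z + \<zeta> *s b) - Re (p \<zeta>)\<bar> < e / 2"
        using circle_approx_Re_entire[OF cf e2] by blast
      have h1: "(\<lambda>\<zeta>. p \<zeta> + of_real (e / 2)) holomorphic_on UNIV" by (intro holomorphic_intros p(1))
      have "ereal (f z) \<le> ereal (Re (p 0 + of_real (e / 2)))"
      proof (rule psh_on_le_Re_holomorphic[OF f disc entire_on_unit_disc[OF h1]])
        fix \<zeta> :: complex assume "norm \<zeta> = 1"
        from p(2)[OF this] have "f (z + \<zeta> *s b) \<le> Re (p \<zeta>) + e / 2" unfolding abs_less_iff by linarith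
        thus "ereal (f (z + \<zeta> *s b)) \<le> ereal (Re (p \<zeta> + of_real (e / 2)))" by simp
      qed
      hence fz: "f z \<le> Re (p 0) + e / 2" by simp
      have h2: "(\<lambda>\<zeta>. q \<zeta> - p \<zeta> + of_real (e / 2)) holomorphic_on UNIV" by (intro holomorphic_intros p(1) q)
      have "u z \<le> ereal (Re (q 0 - p 0 + of_real (e / 2)))"
      proof (rule psh_on_le_Re_holomorphic[OF u disc entire_on_unit_disc[OF h2]])
        fix \<zeta> :: complex assume \<zeta>: "norm \<zeta> = 1"
        have "Re (p \<zeta>) < f (z + \<zeta> *s b) + e / 2" using p(2)[OF \<zeta>] unfolding abs_less_iff by linarith
        thus "u (z + \<zeta> *s b) \<le> ereal (Re (q \<zeta> - p \<zeta> + of_real (e / 2)))"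
          using less[OF \<zeta>] by (cases "u (z + \<zeta> *s b)") auto
      qed
      thus "u z + ereal (f z) \<le> ereal (Re (q 0)) + ereal e"
        using fz by (cases "u z") auto
  qed
qed

section \<open>Functions of logarithmic growth\<close>

lemma lelong_classD:
  assumes "u \<in> lelong_class \<delta>"
  shows "psh_on UNIV u" "\<exists>C. \<forall>z. u z \<le> ereal (\<delta> * log_plus (norm z) + C)"
  using assms by (auto simp: lelong_class_def)

text \<open>
  On the complex line through \<open>a\<close> and \<open>z\<close>, the function is compared with \<open>m + \<kappa> ln (\<bar>\<zeta>\<bar>/\<sigma>)\<close> on an annulus. Because \<open>\<kappa> > \<delta>\<close>, the
  comparison holds on a sufficiently large outer circle, whatever the constant in the growth condition; this makes the resulting
  bound independent of that constant.
\<close>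

lemma bernstein_walsh:
  fixes u :: "complex ^ 'n \<Rightarrow> ereal"
  assumes u: "u \<in> lelong_class \<delta>" and \<delta>: "0 \<le> \<delta>" "\<delta> < \<kappa>" and \<rho>: "\<rho> > 0"
    and m: "\<And>z. norm (z - a) \<le> \<rho> \<Longrightarrow> u z \<le> ereal m"
    and z: "norm (z - a) > \<rho>"
  shows "u z \<le> ereal (m + \<kappa> * ln (norm (z - a) / \<rho>))"
proof -
  obtain C where C: "\<And>z. u z \<le> ereal (\<delta> * log_plus (norm z) + C)"
    using lelong_classD(2)[OF u] by blast
  define b where "b = z - a"
  define \<sigma> where "\<sigma> = \<rho> / norm b"
  have nb: "norm b > \<rho>" using z by (simp add: b_def)
  have \<sigma>: "0 < \<sigma>" "\<sigma> < 1" "\<sigma> * norm b = \<rho>" using \<rho> nb order.strict_trans[OF \<rho> nb] by (auto simp: \<sigma>_def)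
  define v where "v \<zeta> = u (a + \<zeta> *s b)" for \<zeta>
  define h where "h \<zeta> = m + \<kappa> * ln (norm \<zeta> / \<sigma>)" for \<zeta> :: complex
  \<comment> \<open>On \<open>\<bar>\<zeta>\<bar> = L \<ge> 1\<close> the growth condition gives \<open>v \<le> h\<close> as soon as \<open>D \<le> (\<kappa> - \<delta>) ln L\<close>.\<close>
  define D where "D = \<delta> * \<bar>ln (norm a + norm b)\<bar> + C - m + \<kappa> * ln \<sigma>"
  define L where "L = exp (max 0 (D / (\<kappa> - \<delta>)))"
  have L: "L \<ge> 1" by (simp add: L_def)
  have ab: "norm a + norm b > 0" using nb \<rho> by (intro add_nonneg_pos) auto
  have far: "v \<zeta> \<le> ereal (h \<zeta>)" if n: "norm \<zeta> = L" for \<zeta>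
  proof -
    have "D / (\<kappa> - \<delta>) \<le> ln L" by (simp add: L_def)
    hence DL: "D \<le> (\<kappa> - \<delta>) * ln L" using \<delta> by (simp add: divide_le_eq mult.commute)
    have "norm (a + \<zeta> *s b) \<le> norm a + L * norm b"
      using norm_triangle_ineq[of a "\<zeta> *s b"] n by (simp add: norm_vector_scalar_mult)
    also have "\<dots> \<le> L * (norm a + norm b)" using mult_right_mono[OF L, of "norm a"] by (simp add: algebra_simps)
    finally have nle: "norm (a + \<zeta> *s b) \<le> L * (norm a + norm b)" .
    have lnL: "ln L \<ge> 0" using L by simp
    have "log_plus (norm (a + \<zeta> *s b)) \<le> ln L + \<bar>ln (norm a + norm b)\<bar>"
    proof (cases "a + \<zeta> *s b = 0")
      case True
      thus ?thesis using lnL by (simp add: log_plus_def)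
    next
      case False
      hence "ln (norm (a + \<zeta> *s b)) \<le> ln (L * (norm a + norm b))"
        using nle L ab by (subst ln_le_cancel_iff) auto
      also have "\<dots> = ln L + ln (norm a + norm b)" using L ab by (subst ln_mult_pos) auto
      finally show ?thesis using lnL by (simp add: log_plus_def)
    qed
    hence "\<delta> * log_plus (norm (a + \<zeta> *s b)) \<le> \<delta> * (ln L + \<bar>ln (norm a + norm b)\<bar>)"
      using \<delta>(1) by (rule mult_left_mono)
    hence "\<delta> * log_plus (norm (a + \<zeta> *s b)) + C \<le> h \<zeta>"
      using DL \<sigma>(1) L unfolding h_def n D_def by (simp add: ln_div algebra_simps)
    hence "ereal (\<delta> * log_plus (norm (a + \<zeta> *s b)) + C) \<le> ereal (h \<zeta>)" by simp
    with C show ?thesis unfolding v_def by (rule order_trans)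
  qed
  have near: "v \<zeta> \<le> ereal (h \<zeta>)" if n: "norm \<zeta> = \<sigma>" for \<zeta>
  proof -
    have "norm (a + \<zeta> *s b - a) \<le> \<rho>" using \<sigma> n by (simp add: norm_vector_scalar_mult)
    from m[OF this] show ?thesis using \<sigma>(1) by (simp add: v_def h_def n)
  qed
  have "v 1 \<le> ereal (h 1)"
  proof (rule maximum_principle[of "cball 0 L - ball 0 \<sigma>" v h 1])
    show "compact (cball 0 L - ball (0::complex) \<sigma>)" by (intro compact_diff) auto
    show "usc_on (cball 0 L - ball 0 \<sigma>) v" unfolding v_def
      by (rule usc_on_complex_line[OF psh_on_usc[OF lelong_classD(1)[OF u]]]) simp
    show "v w \<noteq> \<infinity>" for w unfolding v_def by (rule psh_on_finite[OF lelong_classD(1)[OF u]]) simp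
    show "continuous_on (cball 0 L - ball 0 \<sigma>) h" unfolding h_def
      using \<sigma>(1) by (intro continuous_intros) auto
    show "1 \<in> cball 0 L - ball (0::complex) \<sigma>" using L \<sigma> by simp
    fix w :: complex assume w: "w \<in> cball 0 L - ball 0 \<sigma>"
    show "v w \<le> ereal (h w) \<or>
      (\<exists>s>0. (\<forall>\<zeta>. norm \<zeta> = 1 \<longrightarrow> w + of_real s * \<zeta> \<in> cball 0 L - ball 0 \<sigma>) \<and>
        (\<forall>b c. (\<forall>\<zeta>. norm \<zeta> = 1 \<longrightarrow> v (w + of_real s * \<zeta>) \<le> ereal (h (w + of_real s * \<zeta>) + Re (b * \<zeta>) + c))
           \<longrightarrow> v w \<le> ereal (h w + c)))"
    proof (cases "norm w = L \<or> norm w = \<sigma>")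
      case True
      thus ?thesis using near far by blast
    next
      case False
      hence nw: "\<sigma> < norm w" "norm w < L" using w by auto
      define s where "s = min (norm w - \<sigma>) (L - norm w)"
      have s: "s > 0" "s \<le> norm w - \<sigma>" "s \<le> L - norm w" using nw by (auto simp: s_def)
      have w0: "w \<noteq> 0" using nw \<sigma> by auto
      have inS: "w + of_real s * \<zeta> \<in> cball 0 L - ball 0 \<sigma>" if "norm \<zeta> = 1" for \<zeta>
      proof -
        have "norm (of_real s * \<zeta>) = s" using s that by (simp add: norm_mult)
        thus ?thesis using s norm_triangle_ineq[of w "of_real s * \<zeta>"] norm_diff_ineq[of w "of_real s * \<zeta>"] by auto
      qed
      have small: "norm (of_real s * \<zeta> / w) < 1" if "norm \<zeta> \<le> 1" for \<zeta>
      proof -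
        have "s * norm \<zeta> \<le> s * 1" using s(1) that by (intro mult_left_mono) auto
        also have "\<dots> < norm w" using s \<sigma> by simp
        finally show ?thesis using s(1) w0 by (simp add: norm_mult norm_divide)
      qed
      have pos: "Re (1 + of_real s * \<zeta> / w) > 0" if "norm \<zeta> \<le> 1" for \<zeta>
        using small[OF that] abs_Re_le_cmod[of "of_real s * \<zeta> / w"] by simp
      have "v w \<le> ereal (h w + c)"
        if *: "\<And>\<zeta>. norm \<zeta> = 1 \<Longrightarrow> v (w + of_real s * \<zeta>) \<le> ereal (h (w + of_real s * \<zeta>) + Re (b' * \<zeta>) + c)" for b' c
      proof -
        \<comment> \<open>\<open>Re q\<close> is \<open>h (w + s \<zeta>) + Re (b' \<zeta>) + c\<close>; expanding \<open>ln \<bar>w + s \<zeta>\<bar>\<close> about \<open>w\<close> keeps \<open>Ln\<close> on its principal branch.\<close>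
        define q where "q \<zeta> = of_real \<kappa> * Ln (1 + of_real s * \<zeta> / w) + of_real (h w) + b' * \<zeta> + of_real c" for \<zeta>
        have hq: "q holomorphic_on cball 0 1" unfolding q_def
          using pos w0 by (intro holomorphic_intros) (auto simp: complex_nonpos_Reals_iff not_le)
        have line: "a + w *s b + \<zeta> *s (of_real s *s b) = a + (w + of_real s * \<zeta>) *s b" for \<zeta>
          by (simp add: vec_eq_iff algebra_simps)
        have "u (a + w *s b) \<le> ereal (Re (q 0))"
        proof (rule psh_on_le_Re_holomorphic[OF lelong_classD(1)[OF u], of "a + w *s b" "of_real s *s b" q])
          fix \<zeta> :: complex assume n: "norm \<zeta> = 1"
          have ne: "1 + of_real s * \<zeta> / w \<noteq> 0"
            using pos[OF eq_refl[OF n]] by (metis less_irrefl zero_complex.sel(1))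
          have "w + of_real s * \<zeta> = w * (1 + of_real s * \<zeta> / w)" using w0 by (simp add: field_simps)
          hence "norm (w + of_real s * \<zeta>) = norm w * norm (1 + of_real s * \<zeta> / w)" by (metis norm_mult)
          hence "ln (norm (w + of_real s * \<zeta>) / \<sigma>) = ln (norm w / \<sigma>) + ln (norm (1 + of_real s * \<zeta> / w))"
            using w0 ne \<sigma>(1) by (simp add: ln_mult_pos ln_div)
          hence "Re (q \<zeta>) = h (w + of_real s * \<zeta>) + Re (b' * \<zeta>) + c"
            unfolding q_def h_def using ne by (simp add: algebra_simps)
          thus "u (a + w *s b + \<zeta> *s (of_real s *s b)) \<le> ereal (Re (q \<zeta>))"
            using *[OF n] unfolding line v_def by simp
        qed (auto intro: holomorphic_on_subset[OF hq] holomorphic_on_imp_continuous_on[OF hq])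
        thus ?thesis unfolding v_def q_def by simp
      qed
      thus ?thesis using s(1) inS by (intro disjI2 exI[of _ s]) blast
    qed
  qed
  thus ?thesis using nb \<rho> by (simp add: v_def h_def \<sigma>_def b_def)
qed

lemma log_plus_nonneg: "0 \<le> log_plus t"
  by (simp add: log_plus_def)

lemma log_plus_mono:
  assumes "0 \<le> s" "s \<le> t"
  shows "log_plus s \<le> log_plus t"
proof (cases "s = 0")
  case True
  thus ?thesis by (simp add: log_plus_def)
next
  case False
  hence "ln s \<le> ln t" using assms by simp
  thus ?thesis by (simp add: log_plus_def)
qed

lemma lelong_classI:
  "psh_on UNIV u \<Longrightarrow> (\<And>z. u z \<le> ereal (\<delta> * log_plus (norm z) + C)) \<Longrightarrow> u \<in> lelong_class \<delta>"
  by (auto simp: lelong_class_def)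

lemma lelong_class_mono:
  fixes u :: "complex ^ 'n \<Rightarrow> ereal"
  assumes "u \<in> lelong_class \<tau>" "\<tau> \<le> \<delta>"
  shows "u \<in> lelong_class \<delta>"
proof -
  obtain C where C: "\<And>z. u z \<le> ereal (\<tau> * log_plus (norm z) + C)"
    using lelong_classD(2)[OF assms(1)] by blast
  show ?thesis
  proof (rule lelong_classI[OF lelong_classD(1)[OF assms(1)]])
    fix z :: "complex ^ 'n"
    have "\<tau> * log_plus (norm z) \<le> \<delta> * log_plus (norm z)"
      using assms(2) log_plus_nonneg by (rule mult_right_mono)
    thus "u z \<le> ereal (\<delta> * log_plus (norm z) + C)" by (intro order_trans[OF C]) simp
  qed
qed

lemma lelong_class_affine:
  fixes u :: "complex ^ 'n \<Rightarrow> ereal"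
  assumes "u \<in> lelong_class \<delta>" "\<alpha> > 0"
  shows "(\<lambda>z. ereal \<alpha> * u z + ereal \<beta>) \<in> lelong_class (\<alpha> * \<delta>)"
proof -
  obtain C where C: "\<And>z. u z \<le> ereal (\<delta> * log_plus (norm z) + C)"
    using lelong_classD(2)[OF assms(1)] by blast
  show ?thesis
  proof (rule lelong_classI[OF psh_on_affine[OF lelong_classD(1)[OF assms(1)] assms(2)]])
    fix z :: "complex ^ 'n"
    have "(\<alpha> * \<delta> * log_plus (norm z) + (\<alpha> * C + \<beta>) - \<beta>) / \<alpha> = \<delta> * log_plus (norm z) + C"
      using assms(2) by (simp add: field_simps)
    thus "ereal \<alpha> * u z + ereal \<beta> \<le> ereal (\<alpha> * \<delta> * log_plus (norm z) + (\<alpha> * C + \<beta>))"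
      unfolding ereal_affine_le_iff[OF assms(2)] using C[of z] by simp
  qed
qed

lemma zero_in_lelong_class: "0 \<le> \<delta> \<Longrightarrow> (\<lambda>_. 0) \<in> lelong_class \<delta>"
  using psh_on_const[OF open_UNIV, of 0] by (intro lelong_classI[of _ _ 0]) (simp_all add: zero_ereal_def log_plus_nonneg)

section \<open>Extremal functions\<close>

lemma usc_reg_ge: "f z \<le> usc_reg f z"
proof (rule ccontr)
  assume "\<not> f z \<le> usc_reg f z"
  hence "Limsup (nhds z) f < f z" by (simp add: usc_reg_def)
  hence "eventually (\<lambda>x. f x < f z) (nhds z)" by (rule Limsup_lessD)
  thus False using eventually_nhds_x_imp_x by fastforce
qed

lemma usc_reg_le:
  "eventually (\<lambda>x. f x \<le> t) (nhds z) \<Longrightarrow> usc_reg f z \<le> t"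
  unfolding usc_reg_def by (rule Limsup_bounded)

lemma relative_extremal_upper:
  assumes "psh_on B u" "\<And>w. w \<in> B \<Longrightarrow> -1 \<le> u w \<and> u w \<le> 0" "\<And>w. w \<in> E \<Longrightarrow> u w \<le> -1"
  shows "u z \<le> relative_extremal E B z"
  unfolding relative_extremal_def using assms by (intro SUP_upper) auto

lemma relative_extremal_least:
  assumes "\<And>u. \<lbrakk>psh_on B u; \<And>w. w \<in> B \<Longrightarrow> -1 \<le> u w \<and> u w \<le> 0; \<And>w. w \<in> E \<Longrightarrow> u w \<le> -1\<rbrakk> \<Longrightarrow> u z \<le> t"
  shows "relative_extremal E B z \<le> t"
  unfolding relative_extremal_def using assms by (intro SUP_least) auto

lemma usc_reg_relative_extremal_bounds:
  assumes "open B" "a \<in> B"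
  shows "-1 \<le> usc_reg (relative_extremal E B) a" "usc_reg (relative_extremal E B) a \<le> 0"
proof -
  have m1: "ereal (-1) = -1" by (simp add: one_ereal_def)
  have "-1 \<le> relative_extremal E B a"
    by (rule relative_extremal_upper[of B "\<lambda>_. -1"]) (use psh_on_const[OF assms(1), of "-1"] m1 in auto)
  thus "-1 \<le> usc_reg (relative_extremal E B) a" by (rule order_trans[OF _ usc_reg_ge])
  have "relative_extremal E B z \<le> 0" if "z \<in> B" for z
    by (rule relative_extremal_least) (use that in blast)
  thus "usc_reg (relative_extremal E B) a \<le> 0"
    using eventually_nhds_in_open[OF assms] by (intro usc_reg_le) (auto elim: eventually_mono)
qed

lemma weighted_extremal_upper:
  assumes "u \<in> lelong_class \<delta>" "\<And>w. w \<in> K \<Longrightarrow> u w \<le> ereal (\<psi> w)"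
  shows "u z \<le> weighted_extremal \<delta> K \<psi> z"
  unfolding weighted_extremal_def using assms by (intro SUP_upper) auto

lemma siciak_extremal_upper:
  assumes "u \<in> lelong_class 1" "\<And>w. w \<in> E \<Longrightarrow> u w \<le> 0"
  shows "u z \<le> siciak_extremal E z"
  unfolding siciak_extremal_def using assms by (intro SUP_upper) auto

lemma siciak_extremal_antimono: "E \<subseteq> E' \<Longrightarrow> siciak_extremal E' z \<le> siciak_extremal E z"
  unfolding siciak_extremal_def by (intro SUP_subset_mono) auto

lemma siciak_extremal_nonneg: "0 \<le> siciak_extremal E z"
  by (rule siciak_extremal_upper[OF zero_in_lelong_class]) simp_all

section \<open>The lower bound for the weighted extremal function\<close>

text \<open>
  The glued function is a maximum of plurisubharmonic functions on \<open>ball a R\<close> and equals \<open>\<Psi>\<close> outside \<open>cball a r\<close>. These two open sets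
  overlap in a shell because \<open>r < R\<close>, and together they cover the space.
\<close>

lemma glued_in_lelong_class:
  fixes \<Psi> :: "complex ^ 'n \<Rightarrow> real"
  assumes \<Psi>: "(\<lambda>z. ereal (\<Psi> z)) \<in> lelong_class \<tau>" and cont: "continuous_on UNIV \<Psi>"
    and strict: "psh_on (ball a R) (\<lambda>z. ereal (\<Psi> z - c * (norm (z - a))\<^sup>2))"
    and c: "c > 0" and r: "0 < r" "r < R"
    and u: "psh_on (ball a R) u" and u01: "\<And>w. w \<in> ball a R \<Longrightarrow> u w \<le> 0"
  defines "g \<equiv> \<lambda>z. ereal (c * r\<^sup>2) * u z + ereal (c * r\<^sup>2) + ereal (\<Psi> z - c * (norm (z - a))\<^sup>2)"
  shows "(\<lambda>z. if z \<in> ball a R then max (ereal (\<Psi> z)) (g z) else ereal (\<Psi> z)) \<in> lelong_class \<tau>"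
    (is "?G \<in> _")
    and "\<And>z. z \<in> ball a R \<Longrightarrow> norm (z - a) > r \<Longrightarrow> g z \<le> ereal (\<Psi> z)"
proof -
  have cr: "c * r\<^sup>2 > 0" using c r by simp
  have g_le: "g z \<le> ereal (c * r\<^sup>2 + \<Psi> z - c * (norm (z - a))\<^sup>2)" if "z \<in> ball a R" for z
  proof -
    have "ereal (c * r\<^sup>2) * u z + ereal (c * r\<^sup>2) \<le> ereal (c * r\<^sup>2)"
      unfolding ereal_affine_le_iff[OF cr] using u01[OF that] by (simp add: zero_ereal_def)
    hence "g z \<le> ereal (c * r\<^sup>2) + ereal (\<Psi> z - c * (norm (z - a))\<^sup>2)"
      unfolding g_def by (rule add_right_mono)
    thus ?thesis by (simp add: algebra_simps)
  qed
  show far: "g z \<le> ereal (\<Psi> z)" if "z \<in> ball a R" "norm (z - a) > r" for z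
  proof -
    have "r\<^sup>2 \<le> (norm (z - a))\<^sup>2" using that r by (intro power_mono) auto
    hence "c * r\<^sup>2 \<le> c * (norm (z - a))\<^sup>2" using c by simp
    thus ?thesis by (intro order_trans[OF g_le[OF that(1)]]) simp
  qed
  have \<Psi>psh: "psh_on UNIV (\<lambda>z. ereal (\<Psi> z))" by (rule lelong_classD(1)[OF \<Psi>])
  have "psh_on (ball a R) g" unfolding g_def
    by (intro psh_on_add_continuous psh_on_affine u strict cr continuous_intros continuous_on_subset[OF cont]) simp
  hence "psh_on (ball a R) (\<lambda>z. max (ereal (\<Psi> z)) (g z))"
    by (intro psh_on_max psh_on_subset[OF \<Psi>psh]) simp_all
  hence 1: "psh_on (ball a R) ?G" by (rule psh_on_cong) simp
  have 2: "psh_on (- cball a r) ?G"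
    by (rule psh_on_cong[OF psh_on_subset[OF \<Psi>psh]])
       (use far in \<open>auto simp: max_absorb1 dist_norm norm_minus_commute\<close>)
  have "ball a R \<union> - cball a r = UNIV" using r by auto
  with psh_on_Un[OF 1 2] have psh: "psh_on UNIV ?G" by simp
  obtain C where C: "\<And>z. ereal (\<Psi> z) \<le> ereal (\<tau> * log_plus (norm z) + C)"
    using lelong_classD(2)[OF \<Psi>] by blast
  show "?G \<in> lelong_class \<tau>"
  proof (rule lelong_classI[OF psh])
    fix z :: "complex ^ 'n"
    have "?G z \<le> ereal (\<Psi> z + c * r\<^sup>2)"
    proof (cases "z \<in> ball a R")
      case True
      have "c * (norm (z - a))\<^sup>2 \<ge> 0" using c by simp
      hence "g z \<le> ereal (\<Psi> z + c * r\<^sup>2)" by (intro order_trans[OF g_le[OF True]]) simp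
      thus ?thesis using cr True by simp
    qed (use cr in simp)
    also have "\<dots> \<le> ereal (\<tau> * log_plus (norm z) + (C + c * r\<^sup>2))" using C[of z] by simp
    finally show "?G z \<le> ereal (\<tau> * log_plus (norm z) + (C + c * r\<^sup>2))" .
  qed
qed

text \<open>
  Pointwise, a bound \<open>y\<close> for the weighted extremal function at \<open>z\<close> becomes the bound \<open>\<phi> y z\<close> for the relative extremal function, where
  \<open>\<phi> y\<close> is continuous; therefore it persists in the upper limit at \<open>a\<close>.
\<close>

lemma weighted_extremal_reg_ge:
  fixes \<Psi> :: "complex ^ 'n \<Rightarrow> real"
  assumes \<Psi>: "(\<lambda>z. ereal (\<Psi> z)) \<in> lelong_class \<tau>" and cont: "continuous_on UNIV \<Psi>"
    and strict: "psh_on (ball a R) (\<lambda>z. ereal (\<Psi> z - c * (norm (z - a))\<^sup>2))"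
    and c: "c > 0" and r: "0 < r" "r < R" and \<delta>: "\<tau> \<le> \<delta>"
    and \<psi>: "\<And>z. z \<in> K \<Longrightarrow> \<psi> z = \<Psi> z"
  shows "ereal (\<Psi> a) + ereal (c * r\<^sup>2) * (1 + usc_reg (relative_extremal (K \<inter> cball a r) (ball a R)) a)
    \<le> weighted_extremal_reg \<delta> K \<psi> a"
proof -
  let ?h = "relative_extremal (K \<inter> cball a r) (ball a R)"
  have cr: "c * r\<^sup>2 > 0" using c r by simp
  have aB: "a \<in> ball a R" using r by simp
  define \<phi> where "\<phi> y z = (y - (c * r\<^sup>2 + \<Psi> z - c * (norm (z - a))\<^sup>2)) / (c * r\<^sup>2)" for y z
  have h_le: "?h z \<le> ereal (\<phi> y z)" if z: "z \<in> ball a R" and V: "weighted_extremal \<delta> K \<psi> z \<le> ereal y" for z y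
  proof (rule relative_extremal_least)
    fix u assume u: "psh_on (ball a R) u" "\<And>w. w \<in> ball a R \<Longrightarrow> -1 \<le> u w \<and> u w \<le> 0"
      "\<And>w. w \<in> K \<inter> cball a r \<Longrightarrow> u w \<le> -1"
    define g where "g z = ereal (c * r\<^sup>2) * u z + ereal (c * r\<^sup>2) + ereal (\<Psi> z - c * (norm (z - a))\<^sup>2)" for z
    define G where "G z = (if z \<in> ball a R then max (ereal (\<Psi> z)) (g z) else ereal (\<Psi> z))" for z
    have u_le_0: "u w \<le> 0" if "w \<in> ball a R" for w using u(2)[OF that] by blast
    have "G \<in> lelong_class \<tau>"
      unfolding G_def[abs_def] g_def
      by (rule glued_in_lelong_class(1)[OF \<Psi> cont strict c r u(1)]) (rule u_le_0)
    hence "G \<in> lelong_class \<delta>" using \<delta> by (rule lelong_class_mono)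
    moreover have "G w \<le> ereal (\<psi> w)" if w: "w \<in> K" for w
    proof (cases "w \<in> ball a R")
      case True
      have "g w \<le> ereal (\<Psi> w)"
      proof (cases "norm (w - a) > r")
        case near: False
        have "ereal (c * r\<^sup>2) * u w + ereal (c * r\<^sup>2) \<le> ereal 0"
        proof -
          have "w \<in> K \<inter> cball a r" using w near by (simp add: dist_norm norm_minus_commute)
          moreover have "(0 - c * r\<^sup>2) / (c * r\<^sup>2) = -1" using c r by simp
          ultimately show ?thesis
            unfolding ereal_affine_le_iff[OF cr] using u(3)[of w] by (simp add: one_ereal_def)
        qed
        hence "g w \<le> ereal 0 + ereal (\<Psi> w - c * (norm (w - a))\<^sup>2)"
          unfolding g_def by (rule add_right_mono)
        also have "\<dots> \<le> ereal (\<Psi> w)" using c by simp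
        finally show ?thesis .
      next
        case far: True
        show ?thesis
          unfolding g_def
          by (rule glued_in_lelong_class(2)[OF \<Psi> cont strict c r u(1) _ True far]) (rule u_le_0)
      qed
      thus ?thesis using True \<psi>[OF w] by (simp add: G_def)
    qed (use \<psi>[OF w] in \<open>simp add: G_def\<close>)
    ultimately have "G z \<le> weighted_extremal \<delta> K \<psi> z" by (rule weighted_extremal_upper)
    moreover have "g z \<le> G z" using z by (simp add: G_def)
    ultimately have "g z \<le> ereal y" using V by (meson order_trans)
    moreover have "g z = ereal (c * r\<^sup>2) * u z + ereal (c * r\<^sup>2 + \<Psi> z - c * (norm (z - a))\<^sup>2)"
      unfolding g_def add.assoc plus_ereal.simps(1) by (simp add: algebra_simps)
    ultimately show "u z \<le> ereal (\<phi> y z)"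
      unfolding \<phi>_def by (simp only: ereal_affine_le_iff[OF cr])
  qed
  obtain k where k: "usc_reg ?h a = ereal k"
    using usc_reg_relative_extremal_bounds[OF open_ball aB, of "K \<inter> cball a r"]
    by (cases "usc_reg ?h a") auto
  have "ereal (\<Psi> a + c * r\<^sup>2 * (1 + k)) \<le> weighted_extremal_reg \<delta> K \<psi> a"
  proof (rule ccontr)
    assume "\<not> ereal (\<Psi> a + c * r\<^sup>2 * (1 + k)) \<le> weighted_extremal_reg \<delta> K \<psi> a"
    hence "weighted_extremal_reg \<delta> K \<psi> a < ereal (\<Psi> a + c * r\<^sup>2 * (1 + k))" by simp
    then obtain y where y: "weighted_extremal_reg \<delta> K \<psi> a < ereal y" "ereal y < ereal (\<Psi> a + c * r\<^sup>2 * (1 + k))"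
      using ereal_dense2 by blast
    have "eventually (\<lambda>z. weighted_extremal \<delta> K \<psi> z < ereal y) (nhds a)"
      using y(1) unfolding weighted_extremal_reg_def usc_reg_def by (rule Limsup_lessD)
    moreover have "eventually (\<lambda>z. z \<in> ball a R) (nhds a)"
      by (rule eventually_nhds_in_open[OF open_ball aB])
    ultimately have "eventually (\<lambda>z. ?h z \<le> ereal (\<phi> y z)) (nhds a)"
      by eventually_elim (simp add: h_le less_imp_le)
    hence "usc_reg ?h a \<le> Limsup (nhds a) (\<lambda>z. ereal (\<phi> y z))"
      unfolding usc_reg_def by (rule Limsup_mono)
    also have "\<dots> = ereal (\<phi> y a)"
    proof (rule lim_imp_Limsup)
      have "continuous_on UNIV (\<phi> y)" unfolding \<phi>_def using cr by (intro continuous_intros cont) auto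
      hence "isCont (\<phi> y) a" by (simp add: continuous_on_eq_continuous_at)
      hence "(\<phi> y \<longlongrightarrow> \<phi> y a) (nhds a)" by (simp add: isCont_def tendsto_at_iff_tendsto_nhds)
      thus "((\<lambda>z. ereal (\<phi> y z)) \<longlongrightarrow> ereal (\<phi> y a)) (nhds a)" by (rule tendsto_ereal)
    qed simp
    finally have "k \<le> (y - (c * r\<^sup>2 + \<Psi> a)) / (c * r\<^sup>2)" unfolding k \<phi>_def by simp
    hence "k * (c * r\<^sup>2) \<le> y - (c * r\<^sup>2 + \<Psi> a)" by (subst (asm) pos_le_divide_eq[OF cr])
    thus False using y(2) by (simp add: algebra_simps)
  qed
  thus ?thesis unfolding k by (simp add: one_ereal_def)
qed

section \<open>Weighted regularity and local pluriregularity\<close>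

text \<open>
  On a small ball \<open>\<Psi>\<close> is at most \<open>y = \<Psi> a + e/2\<close>, so \<open>(u - y)/\<delta>\<close> is a competitor of the Siciak function of the part of \<open>K\<close> in that ball
  for each weighted competitor \<open>u\<close>.
\<close>

lemma weighted_regular_if_pluriregular:
  fixes \<Psi> :: "complex ^ 'n \<Rightarrow> real"
  assumes \<Psi>: "(\<lambda>z. ereal (\<Psi> z)) \<in> lelong_class \<delta>" and cont: "continuous_on UNIV \<Psi>"
    and \<delta>: "0 < \<delta>" and a: "a \<in> K" and \<psi>: "\<And>z. z \<in> K \<Longrightarrow> \<psi> z = \<Psi> z"
    and reg: "locally_pluriregular_at K a"
  shows "weighted_regular_at \<delta> K \<psi> a"
  unfolding weighted_regular_at_def \<psi>[OF a]
proof (rule order.antisym)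
  have "ereal (\<Psi> a) \<le> weighted_extremal \<delta> K \<psi> a"
    using \<psi> by (intro weighted_extremal_upper[OF \<Psi>]) simp
  thus "ereal (\<Psi> a) \<le> weighted_extremal_reg \<delta> K \<psi> a"
    unfolding weighted_extremal_reg_def by (rule order_trans[OF _ usc_reg_ge])
  show "weighted_extremal_reg \<delta> K \<psi> a \<le> ereal (\<Psi> a)"
  proof (rule ereal_le_epsilon2)
    fix e :: real assume e: "0 < e"
    define y where "y = \<Psi> a + e / 2"
    have "isCont \<Psi> a" using cont by (simp add: continuous_on_eq_continuous_at)
    then obtain d where d: "d > 0" "\<And>z. dist z a < d \<Longrightarrow> dist (\<Psi> z) (\<Psi> a) < e / 2"
      using e unfolding continuous_at_eps_delta by (metis half_gt_zero)
    have near: "\<Psi> z \<le> y" if "z \<in> cball a (d / 2)" for z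
    proof -
      have "dist z a < d" using that d(1) by (simp add: dist_commute)
      from d(2)[OF this] show ?thesis unfolding y_def dist_real_def by linarith
    qed
    have "usc_reg (siciak_extremal (K \<inter> cball a (d / 2))) a < ereal (e / 2 / \<delta>)"
      using reg d(1) e \<delta> by (simp add: locally_pluriregular_at_def)
    hence "eventually (\<lambda>z. siciak_extremal (K \<inter> cball a (d / 2)) z < ereal (e / 2 / \<delta>)) (nhds a)"
      unfolding usc_reg_def by (rule Limsup_lessD)
    hence "eventually (\<lambda>z. weighted_extremal \<delta> K \<psi> z \<le> ereal (\<Psi> a) + ereal e) (nhds a)"
    proof eventually_elim
      case (elim z)
      show ?case unfolding weighted_extremal_def
      proof (rule SUP_least)
        fix u assume "u \<in> {u \<in> lelong_class \<delta>. \<forall>w\<in>K. u w \<le> ereal (\<psi> w)}"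
        hence u: "u \<in> lelong_class \<delta>" "\<And>w. w \<in> K \<Longrightarrow> u w \<le> ereal (\<Psi> w)" using \<psi> by auto
        have id: "1 / \<delta> > 0" using \<delta> by simp
        let ?v = "\<lambda>z. ereal (1 / \<delta>) * u z + ereal (- y / \<delta>)"
        have "?v \<in> lelong_class 1" using lelong_class_affine[OF u(1) id, of "- y / \<delta>"] \<delta> by simp
        moreover have "?v w \<le> 0" if "w \<in> K \<inter> cball a (d / 2)" for w
        proof -
          have "u w \<le> ereal (\<Psi> w)" using that u(2) by simp
          also have "\<dots> \<le> ereal y" using near that by simp
          finally show ?thesis unfolding zero_ereal_def ereal_affine_le_iff[OF id] using \<delta> by simp
        qed
        ultimately have "?v z \<le> siciak_extremal (K \<inter> cball a (d / 2)) z" by (rule siciak_extremal_upper)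
        hence "?v z \<le> ereal (e / 2 / \<delta>)" using elim by simp
        hence "u z \<le> ereal ((e / 2 / \<delta> - - y / \<delta>) / (1 / \<delta>))" unfolding ereal_affine_le_iff[OF id] .
        also have "(e / 2 / \<delta> - - y / \<delta>) / (1 / \<delta>) = \<Psi> a + e"
          using \<delta> by (simp add: y_def field_simps)
        finally show "u z \<le> ereal (\<Psi> a) + ereal e" by simp
      qed
    qed
    thus "weighted_extremal_reg \<delta> K \<psi> a \<le> ereal (\<Psi> a) + ereal e"
      unfolding weighted_extremal_reg_def by (rule usc_reg_le)
  qed
qed

text \<open>
  The truncation \<open>max (u/M - 1) (-1)\<close> is a competitor of the relative extremal function.
\<close>

lemma psh_le_relative_extremal:
  assumes u: "psh_on B u" "\<And>w. w \<in> E \<Longrightarrow> u w \<le> 0"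
    and B: "\<And>w. w \<in> B \<Longrightarrow> u w \<le> ereal M" and M: "M > 0"
    and z: "relative_extremal E B z \<le> ereal s"
  shows "u z \<le> ereal (M * (1 + s))"
proof -
  have iM: "1 / M > 0" using M by simp
  have m1: "ereal (-1) = -1" "-1 \<le> ereal 0" by (simp_all add: one_ereal_def)
  let ?v = "\<lambda>z. ereal (1 / M) * u z + ereal (-1)"
  have "psh_on B (\<lambda>z. max (?v z) (ereal (-1)))"
    by (intro psh_on_max psh_on_affine psh_on_const u(1) iM psh_on_open[OF u(1)])
  moreover have "?v w \<le> ereal 0" if "w \<in> B" for w
    unfolding ereal_affine_le_iff[OF iM] using B[OF that] by simp
  moreover have "?v w \<le> ereal (-1)" if "w \<in> E" for w
    unfolding ereal_affine_le_iff[OF iM] using u(2)[OF that] by (simp add: zero_ereal_def)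
  ultimately have "max (?v z) (ereal (-1)) \<le> relative_extremal E B z"
    by (intro relative_extremal_upper) (auto simp: m1 zero_ereal_def)
  hence "max (?v z) (ereal (-1)) \<le> ereal s" using z by (rule order_trans)
  hence "?v z \<le> ereal s" by (rule order_trans[OF max.cobounded1])
  hence "u z \<le> ereal ((s - -1) / (1 / M))" unfolding ereal_affine_le_iff[OF iM] .
  thus ?thesis by (simp add: algebra_simps)
qed

text \<open>
  A bootstrap: the relative extremal function halves a bound near \<open>a\<close>, and \<open>bernstein_walsh\<close> returns it to \<open>ball a R\<close> at a cost \<open>d\<close>
  that depends on the two radii only. The set \<open>S\<close> of upper bounds of a competitor on \<open>ball a R\<close> is mapped to itself by
  \<open>M \<mapsto> M/2 + d\<close>, so its infimum is at most \<open>2 d\<close>.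
\<close>

lemma lelong_uniformly_bounded:
  fixes a :: "complex ^ 'n"
  assumes R: "R > 0" and h: "usc_reg (relative_extremal E (ball a R)) a < ereal (-1/2)"
  obtains D :: real where "D > 0"
    "\<And>u z. \<lbrakk>u \<in> lelong_class 1; \<And>w. w \<in> E \<Longrightarrow> u w \<le> 0; z \<in> ball a R\<rbrakk> \<Longrightarrow> u z \<le> ereal D"
proof -
  have "eventually (\<lambda>z. relative_extremal E (ball a R) z < ereal (-1/2)) (nhds a)"
    using h unfolding usc_reg_def by (rule Limsup_lessD)
  then obtain e where e: "e > 0" "\<And>z. dist z a < e \<Longrightarrow> relative_extremal E (ball a R) z < ereal (-1/2)"
    unfolding eventually_nhds_metric by blast
  define \<rho> where "\<rho> = min e R / 2"
  have \<rho>: "0 < \<rho>" "\<rho> < e" "\<rho> < R" using e R by (auto simp: \<rho>_def)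
  define d where "d = 2 * ln (R / \<rho>)"
  have d: "d > 0" using \<rho> by (simp add: d_def)
  have "u z \<le> ereal (3 * d)"
    if u: "u \<in> lelong_class 1" "\<And>w. w \<in> E \<Longrightarrow> u w \<le> 0" and z: "z \<in> ball a R" for u z
  proof -
    have psh: "psh_on (ball a R) u"
      by (rule psh_on_subset[OF lelong_classD(1)[OF u(1)]]) simp_all
    define S where "S = {M. M > 0 \<and> (\<forall>z\<in>ball a R. u z \<le> ereal M)}"
    have improve: "M / 2 + d \<in> S" if M: "M \<in> S" for M
    proof -
      have near: "u z \<le> ereal (M / 2)" if "norm (z - a) \<le> \<rho>" for z
      proof -
        have "relative_extremal E (ball a R) z \<le> ereal (-1/2)"
          using that \<rho> by (intro less_imp_le e(2)) (simp add: dist_norm)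
        from psh_le_relative_extremal[OF psh u(2) _ _ this, of M] M
        show ?thesis by (auto simp: S_def)
      qed
      have "u z \<le> ereal (M / 2 + d)" if z: "z \<in> ball a R" for z
      proof (cases "norm (z - a) \<le> \<rho>")
        case True
        have "ereal (M / 2) \<le> ereal (M / 2 + d)" using d by simp
        thus ?thesis using near[OF True] by (rule order_trans[rotated])
      next
        case False
        hence "u z \<le> ereal (M / 2 + 2 * ln (norm (z - a) / \<rho>))"
          by (intro bernstein_walsh[OF u(1) _ _ \<rho>(1) near]) auto
        also have "\<dots> \<le> ereal (M / 2 + d)"
        proof -
          have "norm (z - a) / \<rho> \<le> R / \<rho>"
            using z \<rho> by (intro divide_right_mono) (auto simp: dist_norm norm_minus_commute)
          hence "ln (norm (z - a) / \<rho>) \<le> ln (R / \<rho>)"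
            using False \<rho> by (intro ln_mono divide_pos_pos) auto
          thus ?thesis by (simp add: d_def)
        qed
        finally show ?thesis .
      qed
      thus ?thesis using M d by (auto simp: S_def)
    qed
    obtain C where C: "\<And>z. u z \<le> ereal (1 * log_plus (norm z) + C)"
      using lelong_classD(2)[OF u(1)] by blast
    have "max 1 (log_plus (norm a + R) + C) \<in> S"
    proof -
      have "u z \<le> ereal (max 1 (log_plus (norm a + R) + C))" if "z \<in> ball a R" for z
      proof -
        have "norm z \<le> norm a + R"
          using norm_triangle_ineq[of a "z - a"] that by (simp add: dist_norm norm_minus_commute)
        hence "log_plus (norm z) \<le> log_plus (norm a + R)" by (intro log_plus_mono) auto
        hence "1 * log_plus (norm z) + C \<le> max 1 (log_plus (norm a + R) + C)" by linarith
        hence "ereal (1 * log_plus (norm z) + C) \<le> ereal (max 1 (log_plus (norm a + R) + C))"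
          by (simp only: ereal_less_eq)
        with C show ?thesis by (rule order_trans)
      qed
      moreover have "max 1 (log_plus (norm a + R) + C) > 0" by (simp add: less_max_iff_disj)
      ultimately show ?thesis unfolding S_def by blast
    qed
    hence ne: "S \<noteq> {}" by blast
    have bdd: "bdd_below S" by (intro bdd_belowI[of _ 0]) (simp add: S_def)
    \<comment> \<open>An element of \<open>S\<close> close to the infimum is enough, at the price of \<open>3 d\<close> instead of \<open>2 d\<close>.\<close>
    have "Inf S < Inf S + d / 2" using d by simp
    then obtain M where M: "M \<in> S" "M < Inf S + d / 2" using cInf_lessD[OF ne] by blast
    have "Inf S \<le> M / 2 + d" by (rule cInf_lower[OF improve[OF M(1)] bdd])
    hence "M \<le> 3 * d" using M(2) by simp
    moreover have "u z \<le> ereal M" using M(1) z by (simp add: S_def)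
    ultimately show ?thesis by (meson ereal_less_eq(3) order_trans)
  qed
  thus thesis using that[of "3 * d"] d by simp
qed

text \<open>
  With \<open>D\<close> a common bound of the competitors on \<open>ball a R\<close>, they are at most \<open>D (1 + h)\<close>, where \<open>h\<close> is the relative extremal function;
  this tends to 0 at \<open>a\<close>.
\<close>

lemma siciak_extremal_reg_eq_0:
  fixes a :: "complex ^ 'n"
  assumes R: "R > 0" and h: "usc_reg (relative_extremal E (ball a R)) a = -1"
  shows "usc_reg (siciak_extremal E) a = 0"
proof (rule order.antisym)
  show "0 \<le> usc_reg (siciak_extremal E) a"
    by (rule order_trans[OF siciak_extremal_nonneg usc_reg_ge])
  have "usc_reg (relative_extremal E (ball a R)) a < ereal (-1/2)"
    unfolding h by (simp add: one_ereal_def)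
  then obtain D where D: "D > 0"
    "\<And>u z. \<lbrakk>u \<in> lelong_class 1; \<And>w. w \<in> E \<Longrightarrow> u w \<le> 0; z \<in> ball a R\<rbrakk> \<Longrightarrow> u z \<le> ereal D"
    using lelong_uniformly_bounded[OF R] by blast
  show "usc_reg (siciak_extremal E) a \<le> 0"
  proof (rule ereal_le_epsilon2)
    fix e :: real assume e: "0 < e"
    have "usc_reg (relative_extremal E (ball a R)) a < ereal (e / D - 1)"
      unfolding h using e D(1) by (simp add: one_ereal_def)
    hence "eventually (\<lambda>z. relative_extremal E (ball a R) z < ereal (e / D - 1)) (nhds a)"
      unfolding usc_reg_def by (rule Limsup_lessD)
    hence "eventually (\<lambda>z. siciak_extremal E z \<le> ereal e) (nhds a)"
    proof eventually_elim
      case (elim z)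
      show ?case unfolding siciak_extremal_def
      proof (rule SUP_least)
        fix u assume "u \<in> {u \<in> lelong_class 1. \<forall>w\<in>E. u w \<le> 0}"
        hence u: "u \<in> lelong_class 1" "\<And>w. w \<in> E \<Longrightarrow> u w \<le> 0" by auto
        have "u z \<le> ereal (D * (1 + (e / D - 1)))"
          by (rule psh_le_relative_extremal[OF _ u(2) D(2)[OF u] D(1) less_imp_le[OF elim]])
             (rule psh_on_subset[OF lelong_classD(1)[OF u(1)]], simp_all)
        thus "u z \<le> ereal e" using D(1) by simp
      qed
    qed
    thus "usc_reg (siciak_extremal E) a \<le> 0 + ereal e" by (simp add: usc_reg_le)
  qed
qed

text \<open>
  Radii \<open>r \<ge> R\<close> are reduced to a smaller one, because a larger set has a smaller Siciak function.
\<close>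

lemma locally_pluriregularI:
  fixes a :: "complex ^ 'n"
  assumes R: "R > 0"
    and h: "\<And>r. 0 < r \<Longrightarrow> r < R \<Longrightarrow> usc_reg (relative_extremal (K \<inter> cball a r) (ball a R)) a = -1"
  shows "locally_pluriregular_at K a"
  unfolding locally_pluriregular_at_def
proof (intro allI impI)
  fix r :: real assume r: "r > 0"
  define s where "s = min r (R / 2)"
  have s: "0 < s" "s < R" "s \<le> r" using r R by (auto simp: s_def)
  have "usc_reg (siciak_extremal (K \<inter> cball a r)) a \<le> usc_reg (siciak_extremal (K \<inter> cball a s)) a"
    unfolding usc_reg_def using s(3)
    by (intro Limsup_mono always_eventually allI siciak_extremal_antimono) auto
  also have "\<dots> = 0" by (rule siciak_extremal_reg_eq_0[OF R h[OF s(1,2)]])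
  finally show "usc_reg (siciak_extremal (K \<inter> cball a r)) a = 0"
    using order_trans[OF siciak_extremal_nonneg usc_reg_ge] by (intro order.antisym)
qed

theorem theorem4p2:
  fixes K :: "(complex ^ 'n) set" and a :: "complex ^ 'n"
    and \<Psi> \<psi> :: "complex ^ 'n \<Rightarrow> real" and \<tau> R c :: real
  assumes "compact K" and "\<not> pluripolar K" and "a \<in> K" and "\<tau> > 0"
    and "(\<lambda>z. ereal (\<Psi> z)) \<in> lelong_class \<tau>" and "continuous_on UNIV \<Psi>"
    and "\<And>z. z \<in> K \<Longrightarrow> \<psi> z = \<Psi> z"
    and "R > 0" and "c > 0"
    and "psh_on (ball a R) (\<lambda>z. ereal (\<Psi> z - c * (norm (z - a))\<^sup>2))"
  shows "(\<forall>r \<delta>. 0 < r \<and> r < R \<and> \<delta> \<ge> \<tau> \<longrightarrow>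
            weighted_extremal_reg \<delta> K \<psi> a - ereal (\<Psi> a) \<ge>
            ereal (c * r\<^sup>2) * (1 + usc_reg (relative_extremal (K \<inter> cball a r) (ball a R)) a))
       \<and> (\<forall>\<delta>\<ge>\<tau>. weighted_regular_at \<delta> K \<psi> a \<longleftrightarrow> locally_pluriregular_at K a)
       \<and> ((\<exists>\<delta>\<ge>\<tau>. weighted_regular_at \<delta> K \<psi> a) \<longrightarrow>
            (\<forall>\<delta>\<ge>\<tau>. weighted_regular_at \<delta> K \<psi> a))"
proof -
  let ?h = "\<lambda>r. usc_reg (relative_extremal (K \<inter> cball a r) (ball a R)) a"
  have ineq: "ereal (c * r\<^sup>2) * (1 + ?h r) \<le> weighted_extremal_reg \<delta> K \<psi> a - ereal (\<Psi> a)"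
    if "0 < r" "r < R" "\<tau> \<le> \<delta>" for r \<delta>
    using weighted_extremal_reg_ge[OF assms(5,6,10,9) that assms(7)]
    by (simp add: ereal_le_minus add.commute)
  have equiv: "weighted_regular_at \<delta> K \<psi> a \<longleftrightarrow> locally_pluriregular_at K a" if \<delta>: "\<tau> \<le> \<delta>" for \<delta>
  proof
    assume reg: "weighted_regular_at \<delta> K \<psi> a"
    show "locally_pluriregular_at K a"
    proof (rule locally_pluriregularI[OF \<open>R > 0\<close>])
      fix r assume r: "0 < r" "r < R"
      have bounds: "-1 \<le> ?h r" "?h r \<le> 0"
        using usc_reg_relative_extremal_bounds[OF open_ball, of a a R] \<open>R > 0\<close> by simp_all
      then obtain k where k: "?h r = ereal k" by (cases "?h r") auto
      have "ereal (c * r\<^sup>2) * (1 + ?h r) \<le> 0"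
        using ineq[OF r \<delta>] reg assms(7)[OF \<open>a \<in> K\<close>] by (simp add: weighted_regular_at_def zero_ereal_def)
      hence "c * r\<^sup>2 * (1 + k) \<le> 0" by (simp add: k one_ereal_def zero_ereal_def)
      moreover have "c * r\<^sup>2 > 0" using \<open>c > 0\<close> r by simp
      ultimately have "\<not> 1 + k > 0" using mult_pos_pos[of "c * r\<^sup>2" "1 + k"] by linarith
        hence "k \<le> -1" by simp
      thus "?h r = -1" using bounds k by (simp add: one_ereal_def)
    qed
  next
    assume "locally_pluriregular_at K a"
    thus "weighted_regular_at \<delta> K \<psi> a"
      using weighted_regular_if_pluriregular[OF lelong_class_mono[OF assms(5) \<delta>] assms(6) _ assms(3,7)] assms(4) \<delta>
      by simp
  qed
  show ?thesis using ineq equiv by blast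
qed

end
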